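(* Let $\mathcal H_N=\mathcal H_M\otimes\mathcal H_{N\backslash M}$ be finite-dimensional, $k\in[0,\log|N|]$, $\varepsilon>0$, and let $\{U_N^1,\dots,U_N^{|D|}\}$ be unitaries on $\mathcal H_N$ forming a strong $(k,\varepsilon)$-quantum Rényi 2-extractor. Then $\{U_N^1,\dots,U_N^{|D|}\}$ is a strong $(k,\varepsilon)$-quantum Rényi 2-extractor against quantum side information.
   Context: Logarithms are base 2, $|N|=\dim\mathcal H_N$, and $\mathrm{tr}_{N\backslash M}$ is the partial trace over the complement of $\mathcal H_M$ in $\mathcal H_N$. All Hilbert spaces are finite-dimensional; $\{|i\rangle_D\}$ is an orthonormal basis of $\mathcal H_D$. Strong $(k,\varepsilon)$-quantum Rényi 2-extractor: for every positive semi-definite operator $\rho_N$ on $\mathcal H_N$ with $H_2(N)_\rho\ge k$, $$H_2(MD)_\sigma\ge\log\left(\frac{|M|\cdot|D|}{\varepsilon+1}\right),\qquad\sigma_{MD}=\frac1{|D|}\sum_{i=1}^{|D|}\mathrm{tr}_{N\backslash M}\left[U_N^i\rho_N(U_N^i)^\dagger\right]\otimes|i\rangle\langle i|_D,$$ with $H_2(N)_\rho=-\log\mathrm{tr}[\rho_N^2]$. Strong $(k,\varepsilon)$-quantum Rényi 2-extractor against quantum side information: for every finite-dimensional $\mathcal H_R$ and every positive semi-definite $\rho_{NR}$ on $\mathcal H_N\otimes\mathcal H_R$ with $H_2(N|R)_\rho\ge k$, $$H_2(MD|R)_\sigma\ge\log\left(\frac{|M|\cdot|D|}{\varepsilon+1}\right),\qquad\sigma_{MDR}=\frac1{|D|}\sum_{i=1}^{|D|}\mathrm{tr}_{N\backslash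 M}\left[U_N^i\rho_{NR}(U_N^i)^\dagger\right]\otimes|i\rangle\langle i|_D .$$ Conditional Rényi 2-entropy: $H_2(A|B)_\rho=-\log\mathrm{tr}\left[\rho_{AB}(1_A\otimes\rho_B)^{-1/2}\rho_{AB}(1_A\otimes\rho_B)^{-1/2}\right]$ for positive semi-definite $\rho_{AB}$, with generalized inverses. *)

theory Defs
  imports
    "Jordan_Normal_Form.Schur_Decomposition"
    "HOL-Library.Extended_Real"
    Complex_Main
begin

text \<open>
  The Hilbert space of dimension \<open>n\<close> is \<open>complex vec\<close> of length \<open>n\<close>, operators on it are
  \<open>complex mat\<close> of size \<open>n \<times> n\<close>, and the tensor product is the Kronecker product: the basis vector
  \<open>|i\<rangle>\<otimes>|j\<rangle>\<close> of a product of spaces of dimensions \<open>a\<close> and \<open>b\<close> has index \<open>i * b + j\<close>.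
  All indices start at 0.
\<close>

subsection \<open>Operators\<close>

definition unitary_mat :: "nat \<Rightarrow> complex mat \<Rightarrow> bool" where
  "unitary_mat n U \<longleftrightarrow> U \<in> carrier_mat n n \<and>
     U * mat_adjoint U = 1\<^sub>m n \<and> mat_adjoint U * U = 1\<^sub>m n"

text \<open>In the order on \<open>complex\<close>, \<open>0 \<le> z\<close> means that \<open>z\<close> is real and nonnegative.\<close>

definition psd_mat :: "nat \<Rightarrow> complex mat \<Rightarrow> bool" where
  "psd_mat n A \<longleftrightarrow> A \<in> carrier_mat n n \<and> (\<forall>v \<in> carrier_vec n. 0 \<le> (A *\<^sub>v v) \<bullet>c v)"

definition mat_trace :: "complex mat \<Rightarrow> complex" where
  "mat_trace A = (\<Sum>i<dim_row A. A $$ (i, i))"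

definition mat_sum :: "nat \<Rightarrow> (nat \<Rightarrow> complex mat) \<Rightarrow> nat \<Rightarrow> complex mat" where
  "mat_sum n F d = mat n n (\<lambda>p. \<Sum>i<d. F i $$ p)"

definition basis_proj :: "nat \<Rightarrow> nat \<Rightarrow> complex mat" where
  "basis_proj d i = mat d d (\<lambda>(p, q). if p = i \<and> q = i then 1 else 0)"

text \<open>
  Functional calculus for Hermitian matrices: \<open>V diag(l) V\<^sup>\<dagger>\<close> is sent to \<open>V diag(f(l)) V\<^sup>\<dagger>\<close>.
  By the spectral theorem such a decomposition exists, and the result does not depend on it.
\<close>

definition hermitian_fun :: "(real \<Rightarrow> real) \<Rightarrow> complex mat \<Rightarrow> complex mat" where
  "hermitian_fun f A = (THE X. \<exists>V l. unitary_mat (dim_row A) V \<and>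
     A = V * mat_diag (dim_row A) (\<lambda>i. complex_of_real (l i)) * mat_adjoint V \<and>
     X = V * mat_diag (dim_row A) (\<lambda>i. complex_of_real (f (l i))) * mat_adjoint V)"

text \<open>The power \<open>-1/2\<close> of a positive semi-definite matrix, with the generalized inverse.\<close>

definition inv_sqrt_mat :: "complex mat \<Rightarrow> complex mat" where
  "inv_sqrt_mat A = hermitian_fun (\<lambda>x. if x = 0 then 0 else 1 / sqrt x) A"


subsection \<open>Tensor products and partial traces\<close>

definition tensor_mat :: "complex mat \<Rightarrow> complex mat \<Rightarrow> complex mat" (infixr "\<otimes>\<^sub>m" 71) where
  "X \<otimes>\<^sub>m Y = mat (dim_row X * dim_row Y) (dim_col X * dim_col Y)
     (\<lambda>(p, q). X $$ (p div dim_row Y, q div dim_col Y) * Y $$ (p mod dim_row Y, q mod dim_col Y))"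

text \<open>
  Partial trace over the middle factor of a space \<open>A \<otimes> B \<otimes> C\<close> of dimensions \<open>a\<close>, \<open>b\<close>, \<open>c\<close>.
  Taking \<open>a = 1\<close> or \<open>c = 1\<close> gives the partial trace over the first or the last of two factors.
\<close>

definition ptrace :: "nat \<Rightarrow> nat \<Rightarrow> nat \<Rightarrow> complex mat \<Rightarrow> complex mat" where
  "ptrace a b c X = mat (a * c) (a * c)
     (\<lambda>(p, q). \<Sum>j<b. X $$ ((p div c * b + j) * c + p mod c, (q div c * b + j) * c + q mod c))"

text \<open>
  For \<open>X\<close> on \<open>A \<otimes> C\<close> and \<open>Y\<close> on \<open>B\<close>, the operator \<open>X\<^sub>A\<^sub>C \<otimes> Y\<^sub>B\<close> with the factors arranged in the
  order \<open>A \<otimes> B \<otimes> C\<close>; the dimensions are \<open>a\<close>, \<open>b\<close>, \<open>c\<close>.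
\<close>

definition tensor_mid :: "nat \<Rightarrow> nat \<Rightarrow> nat \<Rightarrow> complex mat \<Rightarrow> complex mat \<Rightarrow> complex mat" where
  "tensor_mid a b c X Y = mat (a * b * c) (a * b * c)
     (\<lambda>(p, q). X $$ (p div (b * c) * c + p mod c, q div (b * c) * c + q mod c) *
               Y $$ (p div c mod b, q div c mod b))"


subsection \<open>Entropies\<close>

text \<open>The convention \<open>-log 0 = \<infinity>\<close> only matters for the zero operator, which is positive semi-definite.\<close>

definition neg_log2 :: "real \<Rightarrow> ereal" where
  "neg_log2 x = (if x = 0 then \<infinity> else ereal (- log 2 x))"

definition H2 :: "complex mat \<Rightarrow> ereal" where
  "H2 \<rho> = neg_log2 (Re (mat_trace (\<rho> * \<rho>)))"

text \<open>\<open>H2_cond a b \<rho>\<close> is the entropy of \<open>A\<close> given \<open>B\<close> for \<open>\<rho>\<close> on \<open>A \<otimes> B\<close> of dimensions \<open>a\<close>, \<open>b\<close>.\<close>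

definition H2_cond :: "nat \<Rightarrow> nat \<Rightarrow> complex mat \<Rightarrow> ereal" where
  "H2_cond a b \<rho> =
     (let S = inv_sqrt_mat (1\<^sub>m a \<otimes>\<^sub>m ptrace 1 a b \<rho>)
      in neg_log2 (Re (mat_trace (\<rho> * S * \<rho> * S))))"


subsection \<open>Extractors\<close>

text \<open>
  Dimensions: \<open>m\<close> of \<open>M\<close>, \<open>x\<close> of the complement \<open>N \<setminus> M\<close>, \<open>d\<close> of \<open>D\<close>, \<open>r\<close> of \<open>R\<close>; thus \<open>N = M \<otimes> (N \<setminus> M)\<close>
  has dimension \<open>m * x\<close>. The unitaries are \<open>U 0, \<dots>, U (d - 1)\<close>.
\<close>

definition ext_state :: "nat \<Rightarrow> nat \<Rightarrow> nat \<Rightarrow> (nat \<Rightarrow> complex mat) \<Rightarrow> complex mat \<Rightarrow> complex mat" where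
  "ext_state m x d U \<rho> = (1 / of_nat d) \<cdot>\<^sub>m
     mat_sum (m * d) (\<lambda>i. ptrace m x 1 (U i * \<rho> * mat_adjoint (U i)) \<otimes>\<^sub>m basis_proj d i) d"

text \<open>The state on \<open>M \<otimes> D \<otimes> R\<close> in this order; the unitaries act as \<open>U i \<otimes> 1\<close> on \<open>N \<otimes> R\<close>.\<close>

definition ext_state_side ::
  "nat \<Rightarrow> nat \<Rightarrow> nat \<Rightarrow> nat \<Rightarrow> (nat \<Rightarrow> complex mat) \<Rightarrow> complex mat \<Rightarrow> complex mat" where
  "ext_state_side m x d r U \<rho> = (1 / of_nat d) \<cdot>\<^sub>m
     mat_sum (m * d * r) (\<lambda>i. tensor_mid m d r
       (ptrace m x r ((U i \<otimes>\<^sub>m 1\<^sub>m r) * \<rho> * mat_adjoint (U i \<otimes>\<^sub>m 1\<^sub>m r)))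
       (basis_proj d i)) d"

definition strong_renyi2_extractor ::
  "nat \<Rightarrow> nat \<Rightarrow> nat \<Rightarrow> real \<Rightarrow> real \<Rightarrow> (nat \<Rightarrow> complex mat) \<Rightarrow> bool" where
  "strong_renyi2_extractor m x d k \<epsilon> U \<longleftrightarrow>
     (\<forall>\<rho>. psd_mat (m * x) \<rho> \<and> H2 \<rho> \<ge> ereal k \<longrightarrow>
        H2 (ext_state m x d U \<rho>) \<ge> ereal (log 2 (real m * real d / (\<epsilon> + 1))))"

definition strong_renyi2_extractor_side_info ::
  "nat \<Rightarrow> nat \<Rightarrow> nat \<Rightarrow> real \<Rightarrow> real \<Rightarrow> (nat \<Rightarrow> complex mat) \<Rightarrow> bool" where
  "strong_renyi2_extractor_side_info m x d k \<epsilon> U \<longleftrightarrow>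
     (\<forall>r \<rho>. psd_mat (m * x * r) \<rho> \<and> H2_cond (m * x) r \<rho> \<ge> ereal k \<longrightarrow>
        H2_cond (m * d) r (ext_state_side m x d r U \<rho>)
          \<ge> ereal (log 2 (real m * real d / (\<epsilon> + 1))))"

end

theory Submission
  imports Defs
begin

text \<open>
  Let \<open>T\<close> be the map sending \<open>\<rho>\<close> to the extractor output. By homogeneity the extractor property bounds
  the Hilbert-Schmidt norm of \<open>T X\<close> by that of \<open>X\<close> for positive \<open>X\<close>. The bound extends to Hermitian
  \<open>X = X\<^sub>+ - X\<^sub>-\<close>, since \<open>tr X\<^sub>+ X\<^sub>- = 0\<close> while \<open>tr T(X\<^sub>+) T(X\<^sub>-) \<ge> 0\<close> by complete positivity, and then to
  all \<open>X\<close> by splitting into Hermitian and anti-Hermitian part.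
  As \<open>T\<close> preserves the trace, \<open>\<sigma>\<^sub>R = \<rho>\<^sub>R\<close>, so both conditional entropies are Hilbert-Schmidt norms after
  conjugation with the same \<open>1 \<otimes> \<rho>\<^sub>R\<^sup>-\<^sup>1\<^sup>/\<^sup>4\<close>, and that conjugation commutes with \<open>T \<otimes> id\<^sub>R\<close>.
  Splitting an operator on \<open>N \<otimes> R\<close> into its \<open>R\<close>-indexed blocks, on each of which \<open>T\<close> acts,
  shows that \<open>T \<otimes> id\<^sub>R\<close> obeys the same norm bound.
\<close>

subsection \<open>Index arithmetic and Hermitian matrices\<close>

lemma sum_lessThan_mult:
  fixes f :: "nat \<Rightarrow> 'a :: comm_monoid_add"
  shows "(\<Sum>p<a * b. f p) = (\<Sum>i<a. \<Sum>j<b. f (i * b + j))"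
proof -
  have "(\<Sum>p<a * b. f p) = (\<Sum>i<a. sum f {i * b..<i * b + b})"
    by (rule sum.nat_group[symmetric])
  also have "\<dots> = (\<Sum>i<a. \<Sum>j<b. f (i * b + j))"
  proof (rule sum.cong[OF refl])
    fix i
    show "sum f {i * b..<i * b + b} = (\<Sum>j<b. f (i * b + j))"
      using sum.shift_bounds_nat_ivl[of f 0 "i * b" b]
      by (simp add: atLeast0LessThan add.commute)
  qed
  finally show ?thesis .
qed

lemma mult_add_less_mult:
  fixes i j a b :: nat
  assumes "i < a" "j < b"
  shows "i * b + j < a * b"
proof -
  have "i * b + j < Suc i * b" using assms by simp
  also have "\<dots> \<le> a * b" using assms by (intro mult_right_mono) auto
  finally show ?thesis .
qed

lemma index_mult_mat_sum:
  assumes "A \<in> carrier_mat n k" "B \<in> carrier_mat k m" "i < n" "j < m"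
  shows "(A * B) $$ (i, j) = (\<Sum>l<k. A $$ (i, l) * B $$ (l, j))"
  using assms by (auto simp: scalar_prod_def atLeast0LessThan)

lemma mat_adjoint_dim [simp]:
  "dim_row (mat_adjoint A) = dim_col A" "dim_col (mat_adjoint A) = dim_row A"
  by (auto simp: mat_adjoint_def)

lemma mat_adjoint_carrier [simp]:
  "A \<in> carrier_mat n k \<Longrightarrow> mat_adjoint A \<in> carrier_mat k n"
  by (metis carrier_matD carrier_matI mat_adjoint_dim)

lemma index_mat_adjoint [simp]:
  fixes A :: "complex mat"
  assumes "i < dim_col A" "j < dim_row A"
  shows "mat_adjoint A $$ (i, j) = cnj (A $$ (j, i))"
  using assms by (simp add: mat_adjoint_def mat_of_rows_def)

lemma mat_trace_comm:
  assumes "A \<in> carrier_mat n k" "B \<in> carrier_mat k n"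
  shows "mat_trace (A * B) = mat_trace (B * A)"
proof -
  have "mat_trace (A * B) = (\<Sum>i<n. \<Sum>j<k. A $$ (i, j) * B $$ (j, i))"
    using assms by (simp add: mat_trace_def scalar_prod_def atLeast0LessThan)
  also have "\<dots> = (\<Sum>j<k. \<Sum>i<n. B $$ (j, i) * A $$ (i, j))"
    by (subst sum.swap) (simp add: mult.commute)
  also have "\<dots> = mat_trace (B * A)"
    using assms by (simp add: mat_trace_def scalar_prod_def atLeast0LessThan)
  finally show ?thesis .
qed

section \<open>Hermitian and positive semi-definite matrices\<close>

definition hermitian_mat :: "nat \<Rightarrow> complex mat \<Rightarrow> bool" where
  "hermitian_mat n A \<longleftrightarrow> A \<in> carrier_mat n n \<and> (\<forall>i<n. \<forall>j<n. A $$ (j, i) = cnj (A $$ (i, j)))"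

lemma hermitian_matD:
  assumes "hermitian_mat n A"
  shows "A \<in> carrier_mat n n" "\<And>i j. i < n \<Longrightarrow> j < n \<Longrightarrow> cnj (A $$ (i, j)) = A $$ (j, i)"
  using assms unfolding hermitian_mat_def by metis+

lemma hermitian_matI:
  assumes "A \<in> carrier_mat n n" "\<And>i j. i < n \<Longrightarrow> j < n \<Longrightarrow> cnj (A $$ (i, j)) = A $$ (j, i)"
  shows "hermitian_mat n A"
  using assms unfolding hermitian_mat_def by metis

text \<open>Test vectors become functions on indices, so that they can be given by a formula and
  need no carrier condition.\<close>

lemma psd_mat_iff:
  "psd_mat n A \<longleftrightarrow> A \<in> carrier_mat n n \<and>
     (\<forall>f. 0 \<le> (\<Sum>i<n. \<Sum>j<n. A $$ (i, j) * f j * cnj (f i)))"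
proof (cases "A \<in> carrier_mat n n")
  case True
  have *: "(A *\<^sub>v v) \<bullet>c v = (\<Sum>i<n. \<Sum>j<n. A $$ (i, j) * v $ j * cnj (v $ i))"
    if "v \<in> carrier_vec n" for v
    using that True by (simp add: scalar_prod_def atLeast0LessThan sum_distrib_right)
  show ?thesis
  proof
    assume "psd_mat n A"
    have "0 \<le> (\<Sum>i<n. \<Sum>j<n. A $$ (i, j) * f j * cnj (f i))" for f
    proof -
      have "0 \<le> (A *\<^sub>v vec n f) \<bullet>c vec n f"
        using \<open>psd_mat n A\<close> by (simp add: psd_mat_def)
      then show ?thesis by (simp add: *)
    qed
    with True show "A \<in> carrier_mat n n \<and> (\<forall>f. 0 \<le> (\<Sum>i<n. \<Sum>j<n. A $$ (i, j) * f j * cnj (f i)))"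
      by blast
  next
    assume a: "A \<in> carrier_mat n n \<and> (\<forall>f. 0 \<le> (\<Sum>i<n. \<Sum>j<n. A $$ (i, j) * f j * cnj (f i)))"
    show "psd_mat n A" unfolding psd_mat_def
    proof (intro conjI ballI True)
      fix v :: "complex vec" assume "v \<in> carrier_vec n"
      show "0 \<le> (A *\<^sub>v v) \<bullet>c v"
        unfolding *[OF \<open>v \<in> carrier_vec n\<close>] using a[THEN conjunct2, rule_format, of "\<lambda>i. v $ i"] .
    qed
  qed
qed (simp add: psd_mat_def)

lemma sum_double_two_points:
  fixes g :: "nat \<Rightarrow> nat \<Rightarrow> complex"
  assumes "p < n" "q < n" "p \<noteq> q"
    and "\<And>i j. i \<notin> {p, q} \<or> j \<notin> {p, q} \<Longrightarrow> g i j = 0"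
  shows "(\<Sum>i<n. \<Sum>j<n. g i j) = g p p + g p q + g q p + g q q"
proof -
  have "(\<Sum>i<n. \<Sum>j<n. g i j) = (\<Sum>i\<in>{p, q}. \<Sum>j<n. g i j)"
    using assms by (intro sum.mono_neutral_right) auto
  also have "\<dots> = (\<Sum>i\<in>{p, q}. \<Sum>j\<in>{p, q}. g i j)"
    using assms by (intro sum.cong refl sum.mono_neutral_right) auto
  finally show ?thesis using assms(3) by simp
qed

text \<open>A nonnegative complex number is real, so every value of the quadratic form is real. Unit
  vectors then give a real diagonal, and vectors supported on two indices give the off-diagonal
  entries by polarization.\<close>

lemma psd_mat_hermitian:
  assumes "psd_mat n A"
  shows "hermitian_mat n A"
proof -
  have q: "0 \<le> (\<Sum>i<n. \<Sum>j<n. A $$ (i, j) * f j * cnj (f i))" for f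
    using assms psd_mat_iff by blast
  have diag: "Im (A $$ (p, p)) = 0" if "p < n" for p
  proof -
    define f :: "nat \<Rightarrow> complex" where "f i = (if i = p then 1 else 0)" for i
    have inner: "(\<Sum>j<n. A $$ (i, j) * f j) = (\<Sum>j<n. if j = p then A $$ (i, j) else 0)" for i
      by (intro sum.cong refl) (simp add: f_def)
    have "(\<Sum>i<n. \<Sum>j<n. A $$ (i, j) * f j * cnj (f i)) =
        (\<Sum>i<n. if i = p then \<Sum>j<n. A $$ (i, j) * f j else 0)"
      by (intro sum.cong refl) (simp add: f_def)
    also have "\<dots> = A $$ (p, p)" using that by (simp add: inner)
    finally show ?thesis using q[of f] by (simp add: less_eq_complex_def)
  qed
  have off: "A $$ (q, p) = cnj (A $$ (p, q))" if "p < n" "q < n" "p \<noteq> q" for p q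
  proof -
    have two: "Im (A $$ (p, q) * w + A $$ (q, p) * cnj w) = 0" for w
    proof -
      define f where "f i = (if i = p then 1 else if i = q then w else 0)" for i
      have "(\<Sum>i<n. \<Sum>j<n. A $$ (i, j) * f j * cnj (f i)) =
          A $$ (p, p) + A $$ (p, q) * w + A $$ (q, p) * cnj w + A $$ (q, q) * (w * cnj w)"
        by (subst sum_double_two_points[OF that]) (use that in \<open>auto simp: f_def\<close>)
      moreover have "Im (w * cnj w) = 0" by simp
      ultimately show ?thesis
        using q[of f] diag[OF that(1)] diag[OF that(2)] by (simp add: less_eq_complex_def)
    qed
    \<comment> \<open>The choice \<open>w = 1\<close> makes the imaginary parts of the two entries
      opposite, \<open>w = \<i>\<close> makes their real parts equal.\<close>
    show ?thesis using two[of 1] two[of \<i>] by (simp add: complex_eq_iff)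
  qed
  have "A $$ (j, i) = cnj (A $$ (i, j))" if "i < n" "j < n" for i j
    using diag[of i] off[of i j] that by (cases "i = j") (auto simp: complex_eq_iff)
  moreover have "A \<in> carrier_mat n n" using assms by (simp add: psd_mat_def)
  ultimately show ?thesis unfolding hermitian_mat_def by blast
qed

lemma index_spectral_mat:
  assumes "V \<in> carrier_mat n k" "i < n" "j < n"
  shows "(V * mat_diag k l * mat_adjoint V) $$ (i, j) = (\<Sum>p<k. V $$ (i, p) * l p * cnj (V $$ (j, p)))"
proof -
  have "(V * mat_diag k l) $$ (i, q) = V $$ (i, q) * l q" if "q < k" for q
    using assms that by (simp add: mat_diag_mult_right[OF assms(1)])
  then show ?thesis
    using assms index_mult_mat_sum[of "V * mat_diag k l" n k "mat_adjoint V" n i j]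
    by (simp add: mat_diag_mult_right[OF assms(1)])
qed

subsection \<open>The spectral theorem\<close>

text \<open>This is \<open><A f, g> = <f, A g>\<close> in coordinates. It gives both the
  orthogonality of eigenvectors and the reality of eigenvalues in the induction below.\<close>

lemma hermitian_mat_symmetric:
  assumes "hermitian_mat n A"
  shows "(\<Sum>a<n. (\<Sum>b<n. A $$ (a, b) * f b) * cnj (g a)) = (\<Sum>b<n. f b * cnj (\<Sum>a<n. A $$ (b, a) * g a))"
proof -
  have "(\<Sum>a<n. (\<Sum>b<n. A $$ (a, b) * f b) * cnj (g a)) = (\<Sum>b<n. \<Sum>a<n. A $$ (a, b) * f b * cnj (g a))"
    by (subst sum.swap) (simp add: sum_distrib_right)
  also have "\<dots> = (\<Sum>b<n. \<Sum>a<n. f b * cnj (A $$ (b, a) * g a))"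
    using assms by (intro sum.cong refl) (simp add: hermitian_matD)
  finally show ?thesis by (simp add: sum_distrib_left)
qed

text \<open>A Schur triangular form has the roots of the characteristic polynomial on its diagonal
  and the same trace as \<open>C\<close>. If all roots were \<open>c\<close>, the trace would be
  \<open>n * c\<close>.\<close>

lemma exists_eigenvector_neq:
  fixes C :: "complex mat"
  assumes C: "C \<in> carrier_mat n n" and "mat_trace C \<noteq> of_nat n * c"
  obtains e w where "e \<noteq> c" "\<exists>a<n. w a \<noteq> 0" "\<And>a. a < n \<Longrightarrow> (\<Sum>b<n. C $$ (a, b) * w b) = e * w a"
proof -
  obtain es where cp: "char_poly C = (\<Prod>e\<leftarrow>es. [:- e, 1:])" and len: "length es = n"
    using char_poly_factorized[OF C] by blast
  obtain B P Q where "schur_decomposition C es = (B, P, Q)" by (cases "schur_decomposition C es")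
  from schur_decomposition[OF C cp this]
  have wit: "similar_mat_wit C B P Q" and diag: "diag_mat B = es" by auto
  note D = similar_mat_witD2[OF C wit]
  have "mat_trace C = mat_trace (P * (B * Q))"
    using D by (simp add: assoc_mult_mat[of P n n B n Q n])
  also have "\<dots> = mat_trace (B * Q * P)"
    using D by (intro mat_trace_comm) auto
  also have "B * Q * P = B"
    using D by (simp add: assoc_mult_mat[of B n n Q n P n])
  also have "mat_trace B = sum_list es"
    using D by (simp add: diag[symmetric] mat_trace_def diag_mat_def sum_list_sum_nth atLeast0LessThan)
  finally have tr: "mat_trace C = sum_list es" .
  have "\<exists>e\<in>set es. e \<noteq> c"
  proof (rule ccontr)
    assume "\<not> ?thesis"
    then have "es = replicate n c" using len by (intro replicate_eqI) auto
    then show False using assms(2) tr by (simp add: sum_list_replicate)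
  qed
  then obtain e where e: "e \<in> set es" "e \<noteq> c" by blast
  have "poly (char_poly C) e = 0"
    unfolding cp poly_prod_list using e(1) by (auto simp: prod_list_zero_iff image_iff intro!: bexI[of _ e])
  then have "eigenvalue C e" using eigenvalue_root_char_poly[OF C] by blast
  then obtain v where v: "v \<in> carrier_vec n" "v \<noteq> 0\<^sub>v n" "C *\<^sub>v v = e \<cdot>\<^sub>v v"
    using C by (auto simp: eigenvalue_def eigenvector_def)
  show ?thesis
  proof (rule that[of e "\<lambda>a. v $ a"])
    show "e \<noteq> c" by fact
    show "\<exists>a<n. v $ a \<noteq> 0"
    proof (rule ccontr)
      assume "\<not> ?thesis"
      then have "v = 0\<^sub>v n" using v(1) by (intro eq_vecI) auto
      with v(2) show False by simp
    qed
    fix a assume "a < n"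
    then show "(\<Sum>b<n. C $$ (a, b) * v $ b) = e * v $ a"
      using arg_cong[OF v(3), of "\<lambda>w. w $ a"] C v(1) by (simp add: scalar_prod_def atLeast0LessThan)
  qed
qed

text \<open>Induction on the number \<open>k\<close> of eigenvectors found. The next one comes from
  an eigenvector of a perturbed matrix of the same size, which avoids restricting \<open>A\<close>
  to an orthogonal complement.\<close>

lemma hermitian_mat_eigensystem:
  assumes A: "hermitian_mat n A" and "k \<le> n"
  shows "\<exists>v (l :: nat \<Rightarrow> real).
    (\<forall>j<k. \<forall>a<n. (\<Sum>b<n. A $$ (a, b) * v j b) = l j * v j a) \<and>
    (\<forall>i<k. \<forall>j<k. (\<Sum>a<n. v i a * cnj (v j a)) = (if i = j then 1 else 0))"
  using \<open>k \<le> n\<close>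
proof (induction k)
  case (Suc k)
  from Suc.IH[OF Suc_leD[OF Suc.prems]] obtain v :: "nat \<Rightarrow> nat \<Rightarrow> complex" and l :: "nat \<Rightarrow> real"
    where eig: "\<And>j a. j < k \<Longrightarrow> a < n \<Longrightarrow> (\<Sum>b<n. A $$ (a, b) * v j b) = l j * v j a"
      and orth: "\<And>i j. i < k \<Longrightarrow> j < k \<Longrightarrow> (\<Sum>a<n. v i a * cnj (v j a)) = (if i = j then 1 else 0)"
    by blast
  define z where "z = (mat_trace A - (\<Sum>j<k. of_real (l j))) / of_nat (n - k)"
  \<comment> \<open>Adding 1 to the real part keeps \<open>c\<close> apart from \<open>z\<close>
    even though \<open>z\<close> is not known to be real, and a real \<open>c\<close> keeps the
    matrix \<open>C\<close> below Hermitian.\<close>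
  define c where "c = Re z + 1"
  have c: "complex_of_real c \<noteq> z" by (auto simp: c_def complex_eq_iff)
  \<comment> \<open>Moving the eigenvalues found so far to \<open>c\<close>, with \<open>c\<close> avoiding the mean \<open>z\<close> of the
    remaining ones, forces an eigenvalue different from \<open>c\<close>; its eigenvector is orthogonal to
    the previous ones.\<close>
  define C where "C = mat n n (\<lambda>(a, b). A $$ (a, b) + (\<Sum>j<k. of_real (c - l j) * v j a * cnj (v j b)))"
  have C: "C \<in> carrier_mat n n" by (simp add: C_def)
  have hC: "hermitian_mat n C"
    using A by (intro hermitian_matI) (simp_all add: C_def hermitian_matD(2) ac_simps)
  have "mat_trace C = mat_trace A + (\<Sum>a<n. \<Sum>j<k. of_real (c - l j) * (v j a * cnj (v j a)))"
    using hermitian_matD(1)[OF A] by (simp add: C_def mat_trace_def sum.distrib mult.assoc)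
  also have "(\<Sum>a<n. \<Sum>j<k. of_real (c - l j) * (v j a * cnj (v j a))) =
      (\<Sum>j<k. of_real (c - l j) * (\<Sum>a<n. v j a * cnj (v j a)))"
    by (subst sum.swap) (simp add: sum_distrib_left)
  also have "\<dots> = (\<Sum>j<k. of_real (c - l j))" by (simp add: orth)
  also have "\<dots> = of_nat k * of_real c - (\<Sum>j<k. of_real (l j))" by (simp add: sum_subtractf)
  finally have "mat_trace C = of_nat (n - k) * z + of_nat k * of_real c"
    using Suc.prems by (simp add: z_def)
  then have "mat_trace C - of_nat n * of_real c = of_nat (n - k) * (z - of_real c)"
    using Suc.prems by (simp add: algebra_simps of_nat_diff)
  then have "mat_trace C \<noteq> of_nat n * of_real c" using c Suc.prems by auto
  then obtain e w where e: "e \<noteq> of_real c" and w0: "\<exists>a<n. w a \<noteq> 0"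
    and Cw: "\<And>a. a < n \<Longrightarrow> (\<Sum>b<n. C $$ (a, b) * w b) = e * w a"
    by (rule exists_eigenvector_neq[OF C]) blast
  have C_apply: "(\<Sum>b<n. C $$ (a, b) * f b) =
      (\<Sum>b<n. A $$ (a, b) * f b) + (\<Sum>j<k. of_real (c - l j) * v j a * (\<Sum>b<n. f b * cnj (v j b)))"
    if "a < n" for a f
  proof -
    have "(\<Sum>b<n. C $$ (a, b) * f b) = (\<Sum>b<n. A $$ (a, b) * f b) +
        (\<Sum>b<n. \<Sum>j<k. of_real (c - l j) * v j a * (f b * cnj (v j b)))"
      unfolding sum.distrib[symmetric] using that
      by (intro sum.cong refl) (simp add: C_def distrib_right sum_distrib_right mult.assoc mult.commute[of "f _"])
    also have "(\<Sum>b<n. \<Sum>j<k. of_real (c - l j) * v j a * (f b * cnj (v j b))) =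
        (\<Sum>j<k. of_real (c - l j) * v j a * (\<Sum>b<n. f b * cnj (v j b)))"
      by (subst sum.swap) (simp only: sum_distrib_left)
    finally show ?thesis .
  qed
  \<comment> \<open>On \<open>v i\<close> the matrix \<open>A\<close> contributes \<open>l i\<close>
    and the added term contributes \<open>c - l i\<close>.\<close>
  have Cv: "(\<Sum>b<n. C $$ (a, b) * v i b) = of_real c * v i a" if "a < n" "i < k" for a i
  proof -
    have "(\<Sum>j<k. of_real (c - l j) * v j a * (\<Sum>b<n. v i b * cnj (v j b))) = of_real (c - l i) * v i a"
      using that by (simp add: orth if_distrib cong: if_cong)
    then show ?thesis unfolding C_apply[OF that(1)] using that eig by (simp add: algebra_simps)
  qed
  \<comment> \<open>Comparing \<open><C w, v j>\<close> with \<open><w, C v j>\<close> gives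
    \<open>e * <w, v j> = c * <w, v j>\<close>, where \<open>e\<close> differs from
    \<open>c\<close>. This uses that \<open>c\<close> is real; the reality of \<open>e\<close> is
    shown only later.\<close>
  have wv: "(\<Sum>a<n. w a * cnj (v j a)) = 0" if "j < k" for j
  proof -
    have "e * (\<Sum>a<n. w a * cnj (v j a)) = (\<Sum>a<n. (\<Sum>b<n. C $$ (a, b) * w b) * cnj (v j a))"
      by (simp add: Cw sum_distrib_left mult.assoc)
    also have "\<dots> = (\<Sum>b<n. w b * cnj (\<Sum>a<n. C $$ (b, a) * v j a))"
      by (rule hermitian_mat_symmetric[OF hC])
    also have "\<dots> = (\<Sum>b<n. w b * cnj (of_real c * v j b))"
      by (intro sum.cong refl) (simp only: Cv that lessThan_iff)
    also have "\<dots> = of_real c * (\<Sum>a<n. w a * cnj (v j a))"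
      by (simp add: sum_distrib_left ac_simps)
    finally show ?thesis using e by simp
  qed
  \<comment> \<open>Orthogonality to all \<open>v j\<close> removes the added term, so
    \<open>C\<close> and \<open>A\<close> agree on \<open>w\<close>.\<close>
  have Aw: "(\<Sum>b<n. A $$ (a, b) * w b) = e * w a" if "a < n" for a
    using Cw[OF that] by (simp add: C_apply that wv)
  define s where "s = (\<Sum>a<n. (cmod (w a))\<^sup>2)"
  obtain a0 where "a0 < n" "w a0 \<noteq> 0" using w0 by blast
  then have s: "s > 0" unfolding s_def by (intro sum_pos2[of _ a0]) auto
  have ww: "(\<Sum>a<n. w a * cnj (w a)) = of_real s"
    unfolding s_def of_real_sum complex_norm_square by (rule refl)
  \<comment> \<open>The identity \<open><A w, w> = <w, A w>\<close> forces \<open>e\<close> to equal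
    its conjugate.\<close>
  have "e * of_real s = (\<Sum>a<n. e * w a * cnj (w a))"
    unfolding ww[symmetric] sum_distrib_left mult.assoc by (rule refl)
  also have "\<dots> = (\<Sum>a<n. (\<Sum>b<n. A $$ (a, b) * w b) * cnj (w a))"
    by (intro sum.cong refl) (simp only: Aw lessThan_iff)
  also have "\<dots> = (\<Sum>b<n. w b * cnj (\<Sum>a<n. A $$ (b, a) * w a))"
    by (rule hermitian_mat_symmetric[OF A])
  also have "\<dots> = (\<Sum>b<n. w b * cnj (e * w b))"
    by (intro sum.cong refl) (simp only: Aw lessThan_iff)
  also have "\<dots> = cnj e * of_real s"
    unfolding ww[symmetric] sum_distrib_left by (intro sum.cong refl) (simp add: ac_simps)
  finally have "cnj e = e" using s by simp
  then have e_real: "of_real (Re e) = e" by (simp add: complex_eq_iff)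
  define t where "t = 1 / sqrt s"
  have t: "t * t * s = 1" using s by (simp add: t_def)
  define w' where "w' a = of_real t * w a" for a
  have w'w': "(\<Sum>a<n. w' a * cnj (w' a)) = 1"
  proof -
    have "(\<Sum>a<n. w' a * cnj (w' a)) = of_real (t * t) * (\<Sum>a<n. w a * cnj (w a))"
      unfolding sum_distrib_left by (intro sum.cong refl) (simp add: w'_def ac_simps)
    also have "\<dots> = of_real (t * t * s)" unfolding ww of_real_mult by (rule refl)
    finally show ?thesis unfolding t by simp
  qed
  have w'v: "(\<Sum>a<n. w' a * cnj (v j a)) = 0" if "j < k" for j
    using wv[OF that] unfolding w'_def mult.assoc sum_distrib_left[symmetric] by simp
  have vw': "(\<Sum>a<n. v j a * cnj (w' a)) = 0" if "j < k" for j
  proof -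
    have "(\<Sum>a<n. v j a * cnj (w' a)) = cnj (\<Sum>a<n. w' a * cnj (v j a))"
      unfolding cnj_sum complex_cnj_mult complex_cnj_cnj by (intro sum.cong refl mult.commute)
    then show ?thesis unfolding w'v[OF that] by simp
  qed
  have Aw': "(\<Sum>b<n. A $$ (a, b) * w' b) = of_real (Re e) * w' a" if "a < n" for a
  proof -
    have "(\<Sum>b<n. A $$ (a, b) * w' b) = of_real t * (\<Sum>b<n. A $$ (a, b) * w b)"
      unfolding sum_distrib_left w'_def by (intro sum.cong refl mult.left_commute)
    then show ?thesis unfolding Aw[OF that] e_real w'_def by (simp only: mult.left_commute)
  qed
  show ?case
    by (rule exI[of _ "v(k := w')"], rule exI[of _ "l(k := Re e)"])
      (auto simp: less_Suc_eq eig orth w'w' w'v vw' Aw')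
qed simp

text \<open>The full eigensystem, with \<open>k = n\<close>, supplies the columns of
  \<open>V\<close>. Orthonormality says that the adjoint is a left inverse, which for square
  matrices is also a right inverse.\<close>

theorem hermitian_mat_spectral:
  assumes A: "hermitian_mat n A"
  obtains V l where "unitary_mat n V" "A = V * mat_diag n (\<lambda>i. complex_of_real (l i)) * mat_adjoint V"
proof -
  have cA: "A \<in> carrier_mat n n" using A by (rule hermitian_matD)
  from hermitian_mat_eigensystem[OF A order_refl] obtain v :: "nat \<Rightarrow> nat \<Rightarrow> complex" and l :: "nat \<Rightarrow> real"
    where eig: "\<And>j a. j < n \<Longrightarrow> a < n \<Longrightarrow> (\<Sum>b<n. A $$ (a, b) * v j b) = l j * v j a"
      and orth: "\<And>i j. i < n \<Longrightarrow> j < n \<Longrightarrow> (\<Sum>a<n. v i a * cnj (v j a)) = (if i = j then 1 else 0)"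
    by blast
  define V where "V = mat n n (\<lambda>(a, i). v i a)"
  define D where "D = mat_diag n (\<lambda>i. complex_of_real (l i))"
  have V: "V \<in> carrier_mat n n" by (simp add: V_def)
  have V': "mat_adjoint V \<in> carrier_mat n n" using V by simp
  have D: "D \<in> carrier_mat n n" by (simp add: D_def)
  have "mat_adjoint V * V = 1\<^sub>m n"
  proof (rule eq_matI)
    fix i j assume "i < dim_row (1\<^sub>m n :: complex mat)" "j < dim_col (1\<^sub>m n :: complex mat)"
    then have ij: "i < n" "j < n" by auto
    show "(mat_adjoint V * V) $$ (i, j) = 1\<^sub>m n $$ (i, j)"
      unfolding index_mult_mat_sum[OF V' V ij]
      using orth[of j i] ij by (simp add: V_def mult.commute)
  qed (simp_all add: V_def)
  moreover from this have VV': "V * mat_adjoint V = 1\<^sub>m n"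
    by (rule mat_mult_left_right_inverse[OF V' V])
  ultimately have "unitary_mat n V" using V by (simp add: unitary_mat_def)
  have "A * V = V * D"
  proof (rule eq_matI)
    fix i j assume "i < dim_row (V * D)" "j < dim_col (V * D)"
    then have ij: "i < n" "j < n" using V D by auto
    show "(A * V) $$ (i, j) = (V * D) $$ (i, j)"
      unfolding index_mult_mat_sum[OF cA V ij] D_def mat_diag_mult_right[OF V]
      using eig[of j i] ij by (simp add: V_def mult.commute)
  qed (use cA V D in auto)
  moreover have "A * V * mat_adjoint V = A"
    using cA V V' VV' by (simp add: assoc_mult_mat[of A n n V n "mat_adjoint V" n])
  ultimately have "A = V * D * mat_adjoint V" by simp
  with \<open>unitary_mat n V\<close> show ?thesis using that D_def by blast
qed

subsection \<open>Functional calculus on the second tensor factor\<close>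

lemma spectral_mat_carrier [simp]:
  "V \<in> carrier_mat n n \<Longrightarrow> V * mat_diag n l * mat_adjoint V \<in> carrier_mat n n"
  by (meson mat_adjoint_carrier mat_diag_dim mult_carrier_mat)

lemma mat_diag_dims [simp]: "dim_row (mat_diag n l) = n" "dim_col (mat_diag n l) = n"
  by (simp_all add: mat_diag_def)

text \<open>Discharges the definite description. For a second decomposition with \<open>W\<close>
  and \<open>k\<close>, the matrix \<open>P = mat_adjoint W * V\<close> intertwines the two diagonal
  matrices, so \<open>P $$ (i, j)\<close> can be nonzero only if \<open>l j = k i\<close>, and then
  the values of \<open>f\<close> agree as well. Hence \<open>P\<close> also intertwines the images
  under \<open>f\<close>.\<close>

lemma hermitian_fun_eqI:
  assumes V: "unitary_mat n V"
  shows "hermitian_fun f (V * mat_diag n (\<lambda>i. complex_of_real (l i)) * mat_adjoint V) =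
    V * mat_diag n (\<lambda>i. complex_of_real (f (l i))) * mat_adjoint V"
proof -
  define A where "A = V * mat_diag n (\<lambda>i. complex_of_real (l i)) * mat_adjoint V"
  have cV [simp]: "V \<in> carrier_mat n n" using V by (simp add: unitary_mat_def)
  have cA [simp]: "A \<in> carrier_mat n n" by (simp add: A_def)
  then have n: "dim_row A = n" by (rule carrier_matD)
  note assoc = assoc_mult_mat[of _ n n _ n _ n] mult_carrier_mat[of _ n n _ n]
    left_mult_one_mat[of _ n n] right_mult_one_mat[of _ n n]
  have uniq: "V * mat_diag n (\<lambda>i. complex_of_real (f (l i))) * mat_adjoint V =
      W * mat_diag n (\<lambda>i. complex_of_real (f (k i))) * mat_adjoint W"
    if W: "unitary_mat n W" and AW: "A = W * mat_diag n (\<lambda>i. complex_of_real (k i)) * mat_adjoint W" for W k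
  proof -
    define D where "D g = mat_diag n (\<lambda>i. complex_of_real (g i))" for g
    have cD [simp]: "D g \<in> carrier_mat n n" for g by (simp add: D_def)
    have cW [simp]: "W \<in> carrier_mat n n" using W by (simp add: unitary_mat_def)
    have cV' [simp]: "mat_adjoint V \<in> carrier_mat n n" "mat_adjoint W \<in> carrier_mat n n" by simp_all
    define P where "P = mat_adjoint W * V"
    have P: "P \<in> carrier_mat n n" unfolding P_def by (rule mult_carrier_mat[OF cV'(2) cV])
    have "P * D l = mat_adjoint W * (V * D l * (mat_adjoint V * V))"
      using V by (simp add: P_def unitary_mat_def assoc)
    also have "\<dots> = mat_adjoint W * (A * V)"
      by (simp add: A_def D_def[symmetric] assoc)
    also have "\<dots> = mat_adjoint W * W * D k * P"
      by (simp add: AW D_def[symmetric] P_def assoc)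
    also have "\<dots> = D k * P" using W P by (simp add: unitary_mat_def assoc)
    finally have eq: "P * D l = D k * P" .
    have entry: "P $$ (i, j) * complex_of_real (l j) = complex_of_real (k i) * P $$ (i, j)"
      if "i < n" "j < n" for i j
      using arg_cong[OF eq, of "\<lambda>M. M $$ (i, j)"] that P
      by (simp add: D_def mat_diag_mult_left[OF P] mat_diag_mult_right[OF P])
    have "P * D (\<lambda>i. f (l i)) = D (\<lambda>i. f (k i)) * P"
    proof (rule eq_matI)
      fix i j assume "i < dim_row (D (\<lambda>i. f (k i)) * P)" "j < dim_col (D (\<lambda>i. f (k i)) * P)"
      then have ij: "i < n" "j < n" using P by (auto simp: D_def)
      then show "(P * D (\<lambda>i. f (l i))) $$ (i, j) = (D (\<lambda>i. f (k i)) * P) $$ (i, j)"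
        using entry[OF ij] P
        by (cases "P $$ (i, j) = 0")
          (auto simp: D_def mat_diag_mult_left[OF P] mat_diag_mult_right[OF P] mult.commute)
    qed (use P in \<open>auto simp: D_def\<close>)
    then have "W * (P * D (\<lambda>i. f (l i))) * mat_adjoint V = W * (D (\<lambda>i. f (k i)) * P) * mat_adjoint V"
      by simp
    moreover have "W * (P * D (\<lambda>i. f (l i))) * mat_adjoint V = W * mat_adjoint W * V * D (\<lambda>i. f (l i)) * mat_adjoint V"
      by (simp add: P_def assoc)
    moreover have "W * (D (\<lambda>i. f (k i)) * P) * mat_adjoint V = W * D (\<lambda>i. f (k i)) * mat_adjoint W * (V * mat_adjoint V)"
      by (simp add: P_def assoc)
    ultimately show ?thesis
      using V W by (simp add: unitary_mat_def D_def[symmetric] left_mult_one_mat[of _ n n] right_mult_one_mat[of _ n n] mult_carrier_mat[of _ n n _ n])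
  qed
  show ?thesis
    unfolding hermitian_fun_def A_def[symmetric] n
  proof (rule the_equality)
    show "\<exists>W k. unitary_mat n W \<and> A = W * mat_diag n (\<lambda>i. complex_of_real (k i)) * mat_adjoint W \<and>
        V * mat_diag n (\<lambda>i. complex_of_real (f (l i))) * mat_adjoint V =
        W * mat_diag n (\<lambda>i. complex_of_real (f (k i))) * mat_adjoint W"
      using V A_def by blast
  next
    fix X
    assume "\<exists>W k. unitary_mat n W \<and> A = W * mat_diag n (\<lambda>i. complex_of_real (k i)) * mat_adjoint W \<and>
        X = W * mat_diag n (\<lambda>i. complex_of_real (f (k i))) * mat_adjoint W"
    then obtain W k where "unitary_mat n W"
      and "A = W * mat_diag n (\<lambda>i. complex_of_real (k i)) * mat_adjoint W"
      and X: "X = W * mat_diag n (\<lambda>i. complex_of_real (f (k i))) * mat_adjoint W"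
      by (elim exE conjE)
    then show "X = V * mat_diag n (\<lambda>i. complex_of_real (f (l i))) * mat_adjoint V"
      unfolding X by (intro uniq[symmetric])
  qed
qed

lemma psd_mat_spectral:
  assumes A: "psd_mat n A"
  obtains V l where "unitary_mat n V" "A = V * mat_diag n (\<lambda>i. complex_of_real (l i)) * mat_adjoint V"
    "\<And>i. i < n \<Longrightarrow> 0 \<le> l i"
proof -
  from hermitian_mat_spectral[OF psd_mat_hermitian[OF A]] obtain V l where
    V: "unitary_mat n V" and AV: "A = V * mat_diag n (\<lambda>i. complex_of_real (l i)) * mat_adjoint V" .
  note assoc = assoc_mult_mat[of _ n n _ n _ n] mult_carrier_mat[of _ n n _ n]
    left_mult_one_mat[of _ n n] right_mult_one_mat[of _ n n]
  have cV [simp]: "V \<in> carrier_mat n n" "mat_adjoint V \<in> carrier_mat n n"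
    using V by (simp_all add: unitary_mat_def)
  have cA: "A \<in> carrier_mat n n" using A by (simp add: psd_mat_def)
  have cAV: "A * V \<in> carrier_mat n n" by (rule mult_carrier_mat[OF cA cV(1)])
  have "mat_adjoint V * (A * V) = mat_adjoint V * V * mat_diag n (\<lambda>i. complex_of_real (l i)) * (mat_adjoint V * V)"
    by (simp add: AV assoc)
  then have eq: "mat_adjoint V * (A * V) = mat_diag n (\<lambda>i. complex_of_real (l i))"
    using V by (simp add: unitary_mat_def left_mult_one_mat[of _ n n] right_mult_one_mat[of _ n n] mult_carrier_mat[of _ n n _ n])
  have "0 \<le> l i" if i: "i < n" for i
  proof -
    \<comment> \<open>A diagonal entry of \<open>mat_adjoint V * (A * V)\<close> is the quadratic
      form of \<open>A\<close> at the corresponding column of \<open>V\<close>.\<close>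
    have "complex_of_real (l i) = (\<Sum>a<n. cnj (V $$ (a, i)) * (\<Sum>b<n. A $$ (a, b) * V $$ (b, i)))"
      using arg_cong[OF eq, of "\<lambda>M. M $$ (i, i)"] i carrier_matD[OF cV(1)]
      by (simp add: index_mult_mat_sum[OF cV(2) cAV i i] index_mult_mat_sum[OF cA cV(1)] mat_diag_def
          del: index_mult_mat)
    also have "\<dots> = (\<Sum>a<n. \<Sum>b<n. A $$ (a, b) * V $$ (b, i) * cnj (V $$ (a, i)))"
      by (simp add: sum_distrib_left mult.commute)
    also have "0 \<le> \<dots>" using A unfolding psd_mat_iff by (elim conjE allE)
    finally show ?thesis by (simp add: less_eq_complex_def)
  qed
  with V AV show ?thesis by (rule that)
qed

section \<open>Operators acting on the second tensor factor\<close>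

lemma tensor_one_carrier [simp]:
  "X \<in> carrier_mat r s \<Longrightarrow> 1\<^sub>m a \<otimes>\<^sub>m X \<in> carrier_mat (a * r) (a * s)"
  by (auto simp: tensor_mat_def)

lemma index_tensor_one:
  assumes "X \<in> carrier_mat r r" "i < a" "j < a" "c < r" "e < r"
  shows "(1\<^sub>m a \<otimes>\<^sub>m X) $$ (i * r + c, j * r + e) = (if i = j then X $$ (c, e) else 0)"
  using assms by (simp add: tensor_mat_def mult_add_less_mult)

lemma prod_index_cases:
  fixes p :: nat
  assumes "p < a * r"
  obtains i c where "i < a" "c < r" "p = i * r + c"
proof
  have "r > 0" using assms by (cases r) auto
  then show "p mod r < r" by simp
  show "p div r < a" using assms by (simp add: less_mult_imp_div_less)
  show "p = p div r * r + p mod r" by simp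
qed

lemma prod_index_eq_iff:
  fixes c e :: nat
  assumes "c < r" "e < r"
  shows "i * r + c = j * r + e \<longleftrightarrow> i = j \<and> c = e"
proof
  assume eq: "i * r + c = j * r + e"
  show "i = j \<and> c = e"
    using arg_cong[OF eq, of "\<lambda>p. p div r"] arg_cong[OF eq, of "\<lambda>p. p mod r"] assms by simp
qed simp

lemma eq_mat_prodI:
  assumes "A \<in> carrier_mat (a * r) (a * r)" "B \<in> carrier_mat (a * r) (a * r)"
    and "\<And>i j c e. i < a \<Longrightarrow> j < a \<Longrightarrow> c < r \<Longrightarrow> e < r \<Longrightarrow>
      A $$ (i * r + c, j * r + e) = B $$ (i * r + c, j * r + e)"
  shows "A = B"
proof (rule eq_matI)
  fix p q assume "p < dim_row B" "q < dim_col B"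
  then have "p < a * r" "q < a * r" using assms by auto
  then show "A $$ (p, q) = B $$ (p, q)" by (elim prod_index_cases) (simp add: assms)
qed (use assms in auto)

lemma index_tensor_one_mult:
  assumes X: "X \<in> carrier_mat r r" and Y: "Y \<in> carrier_mat (a * r) m"
    and "i < a" "c < r" "q < m"
  shows "((1\<^sub>m a \<otimes>\<^sub>m X) * Y) $$ (i * r + c, q) = (\<Sum>e<r. X $$ (c, e) * Y $$ (i * r + e, q))"
proof -
  have "((1\<^sub>m a \<otimes>\<^sub>m X) * Y) $$ (i * r + c, q) =
      (\<Sum>j<a. \<Sum>e<r. (1\<^sub>m a \<otimes>\<^sub>m X) $$ (i * r + c, j * r + e) * Y $$ (j * r + e, q))"
    using assms by (subst index_mult_mat_sum[of _ "a * r" "a * r" _ m])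
      (auto simp: mult_add_less_mult sum_lessThan_mult)
  also have "\<dots> = (\<Sum>j<a. if j = i then \<Sum>e<r. X $$ (c, e) * Y $$ (j * r + e, q) else 0)"
    using assms by (intro sum.cong refl) (auto simp: index_tensor_one)
  finally show ?thesis using assms by simp
qed

lemma index_mult_tensor_one:
  assumes X: "X \<in> carrier_mat r r" and Y: "Y \<in> carrier_mat m (a * r)"
    and "i < a" "c < r" "q < m"
  shows "(Y * (1\<^sub>m a \<otimes>\<^sub>m X)) $$ (q, i * r + c) = (\<Sum>e<r. Y $$ (q, i * r + e) * X $$ (e, c))"
proof -
  have "(Y * (1\<^sub>m a \<otimes>\<^sub>m X)) $$ (q, i * r + c) =
      (\<Sum>j<a. \<Sum>e<r. Y $$ (q, j * r + e) * (1\<^sub>m a \<otimes>\<^sub>m X) $$ (j * r + e, i * r + c))"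
    using assms by (subst index_mult_mat_sum[of _ m "a * r" _ "a * r"])
      (auto simp: mult_add_less_mult sum_lessThan_mult)
  also have "\<dots> = (\<Sum>j<a. if j = i then \<Sum>e<r. Y $$ (q, j * r + e) * X $$ (e, c) else 0)"
    using assms by (intro sum.cong refl) (auto simp: index_tensor_one)
  finally show ?thesis using assms by simp
qed

lemma tensor_one_mult:
  assumes X: "X \<in> carrier_mat r r" and Y: "Y \<in> carrier_mat r r"
  shows "(1\<^sub>m a \<otimes>\<^sub>m X) * (1\<^sub>m a \<otimes>\<^sub>m Y) = 1\<^sub>m a \<otimes>\<^sub>m (X * Y)"
proof (rule eq_mat_prodI)
  show "(1\<^sub>m a \<otimes>\<^sub>m X) * (1\<^sub>m a \<otimes>\<^sub>m Y) \<in> carrier_mat (a * r) (a * r)"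
    by (rule mult_carrier_mat[OF tensor_one_carrier[OF X] tensor_one_carrier[OF Y]])
  show "1\<^sub>m a \<otimes>\<^sub>m (X * Y) \<in> carrier_mat (a * r) (a * r)"
    by (rule tensor_one_carrier[OF mult_carrier_mat[OF X Y]])
  fix i j c e assume ij: "i < a" "j < a" and ce: "c < r" "e < r"
  show "((1\<^sub>m a \<otimes>\<^sub>m X) * (1\<^sub>m a \<otimes>\<^sub>m Y)) $$ (i * r + c, j * r + e) = (1\<^sub>m a \<otimes>\<^sub>m (X * Y)) $$ (i * r + c, j * r + e)"
    unfolding index_tensor_one_mult[OF X tensor_one_carrier[OF Y] ij(1) ce(1) mult_add_less_mult[OF ij(2) ce(2)]]
      index_tensor_one[OF mult_carrier_mat[OF X Y] ij ce] index_mult_mat_sum[OF X Y ce]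
    using ij ce by (auto simp: index_tensor_one[OF Y] intro!: sum.cong)
qed

lemma tensor_one_adjoint:
  assumes X: "X \<in> carrier_mat r r"
  shows "mat_adjoint (1\<^sub>m a \<otimes>\<^sub>m X) = 1\<^sub>m a \<otimes>\<^sub>m mat_adjoint X"
  using assms
  by (intro eq_mat_prodI[of _ a r])
    (auto simp: index_tensor_one tensor_mat_def mult_add_less_mult)

lemma tensor_one_one: "1\<^sub>m a \<otimes>\<^sub>m 1\<^sub>m r = (1\<^sub>m (a * r) :: complex mat)"
  by (rule eq_mat_prodI[of _ a r])
    (auto simp: index_tensor_one mult_add_less_mult prod_index_eq_iff)

lemma tensor_one_diag: "1\<^sub>m a \<otimes>\<^sub>m mat_diag r l = mat_diag (a * r) (\<lambda>p. l (p mod r))"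
  by (rule eq_mat_prodI[of _ a r])
    (auto simp: index_tensor_one mult_add_less_mult mat_diag_def prod_index_eq_iff)

lemma tensor_one_unitary:
  assumes "unitary_mat r V"
  shows "unitary_mat (a * r) (1\<^sub>m a \<otimes>\<^sub>m V)"
  using assms unfolding unitary_mat_def
  by (auto simp: tensor_one_adjoint[of _ r] tensor_one_mult[of _ r] tensor_one_one)

text \<open>The factor \<open>q\<close> is \<open>B\<^sup>-\<^sup>1\<^sup>/\<^sup>4\<close>.\<close>

lemma inv_sqrt_tensor_one_psd:
  assumes B: "psd_mat r B"
  obtains q where "hermitian_mat r q" "\<And>a. inv_sqrt_mat (1\<^sub>m a \<otimes>\<^sub>m B) = (1\<^sub>m a \<otimes>\<^sub>m q) * (1\<^sub>m a \<otimes>\<^sub>m q)"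
proof -
  from psd_mat_spectral[OF B] obtain V l where V: "unitary_mat r V"
    and BV: "B = V * mat_diag r (\<lambda>i. complex_of_real (l i)) * mat_adjoint V"
    and l: "\<And>i. i < r \<Longrightarrow> 0 \<le> l i" by blast
  \<comment> \<open>The value 0 at 0 encodes the generalized inverse.\<close>
  define f :: "real \<Rightarrow> real" where "f x = (if x = 0 then 0 else 1 / sqrt x)" for x
  \<comment> \<open>At the eigenvalues \<open>f\<close> is nonnegative, so its square root there
    squares back to \<open>f\<close>.\<close>
  define q where "q = V * mat_diag r (\<lambda>i. complex_of_real (sqrt (f (l i)))) * mat_adjoint V"
  note assoc = assoc_mult_mat[of _ r r _ r _ r] mult_carrier_mat[of _ r r _ r]
    left_mult_one_mat[of _ r r] right_mult_one_mat[of _ r r]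
  have cV [simp]: "V \<in> carrier_mat r r" "mat_adjoint V \<in> carrier_mat r r"
    using V by (simp_all add: unitary_mat_def)
  have cq: "q \<in> carrier_mat r r" by (simp add: q_def)
  have "q * q = V * mat_diag r (\<lambda>i. complex_of_real (sqrt (f (l i)))) * (mat_adjoint V * V) *
      mat_diag r (\<lambda>i. complex_of_real (sqrt (f (l i)))) * mat_adjoint V"
    by (simp add: q_def assoc)
  also have "\<dots> = V * (mat_diag r (\<lambda>i. complex_of_real (sqrt (f (l i)))) *
      mat_diag r (\<lambda>i. complex_of_real (sqrt (f (l i))))) * mat_adjoint V"
    using V by (simp add: unitary_mat_def assoc)
  also have "mat_diag r (\<lambda>i. complex_of_real (sqrt (f (l i)))) *
      mat_diag r (\<lambda>i. complex_of_real (sqrt (f (l i)))) = mat_diag r (\<lambda>i. complex_of_real (f (l i)))"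
    unfolding mat_diag_diag by (rule eq_matI) (auto simp: mat_diag_def f_def l simp flip: of_real_mult)
  finally have qq: "q * q = V * mat_diag r (\<lambda>i. complex_of_real (f (l i))) * mat_adjoint V" .
  show ?thesis
  proof (rule that[of q])
    show "hermitian_mat r q"
      unfolding q_def by (rule hermitian_matI) (simp_all add: index_spectral_mat[OF cV(1)] ac_simps)
    fix a
    \<comment> \<open>The position in the second factor is the remainder modulo \<open>r\<close>,
      hence the eigenvalue \<open>g (p mod r)\<close> at index \<open>p\<close>.\<close>
    have spec: "1\<^sub>m a \<otimes>\<^sub>m (V * mat_diag r g * mat_adjoint V) =
        (1\<^sub>m a \<otimes>\<^sub>m V) * mat_diag (a * r) (\<lambda>p. g (p mod r)) * mat_adjoint (1\<^sub>m a \<otimes>\<^sub>m V)" for g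
      by (simp add: tensor_one_mult[of _ r, symmetric] tensor_one_adjoint[of _ r] tensor_one_diag
          mult_carrier_mat[of _ r r _ r])
    show "inv_sqrt_mat (1\<^sub>m a \<otimes>\<^sub>m B) = (1\<^sub>m a \<otimes>\<^sub>m q) * (1\<^sub>m a \<otimes>\<^sub>m q)"
      unfolding tensor_one_mult[OF cq cq] qq BV spec inv_sqrt_mat_def f_def[symmetric]
      by (rule hermitian_fun_eqI[OF tensor_one_unitary[OF V]])
  qed
qed

section \<open>Conditional entropies as Hilbert-Schmidt norms\<close>

lemma mat_trace_hermitian_square:
  assumes Z: "hermitian_mat n Z"
  shows "mat_trace (Z * Z) = of_real (\<Sum>i<n. \<Sum>j<n. (cmod (Z $$ (i, j)))\<^sup>2)"
proof -
  note cZ = hermitian_matD(1)[OF Z]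
  have "mat_trace (Z * Z) = (\<Sum>i<n. \<Sum>j<n. Z $$ (i, j) * Z $$ (j, i))"
    using cZ by (simp add: mat_trace_def scalar_prod_def atLeast0LessThan)
  also have "\<dots> = (\<Sum>i<n. \<Sum>j<n. Z $$ (i, j) * cnj (Z $$ (i, j)))"
    by (intro sum.cong refl) (simp add: hermitian_matD(2)[OF Z])
  finally show ?thesis by (simp only: of_real_sum complex_norm_square)
qed

text \<open>With \<open>Q\<close> for the lifted \<open>q\<close>, cyclicity of the trace turns
  \<open>\<rho> * S * \<rho> * S\<close> into the square of the Hermitian matrix
  \<open>Q * \<rho> * Q\<close>, whose trace is a sum of squared moduli. The indices of the second
  factor are summed outermost, so that for each pair \<open>c\<close>, \<open>c'\<close> the inner
  sums are the norm of one block, on which the extractor map can act.\<close>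

lemma mat_trace_sandwich:
  assumes \<rho>: "hermitian_mat (a * r) \<rho>" and q: "hermitian_mat r q"
  defines "S \<equiv> (1\<^sub>m a \<otimes>\<^sub>m q) * (1\<^sub>m a \<otimes>\<^sub>m q)"
  shows "Re (mat_trace (\<rho> * S * \<rho> * S)) =
    (\<Sum>c<r. \<Sum>c'<r. \<Sum>i<a. \<Sum>j<a.
      (cmod (\<Sum>e<r. \<Sum>e'<r. q $$ (c, e) * \<rho> $$ (i * r + e, j * r + e') * q $$ (e', c')))\<^sup>2)"
proof -
  define n where "n = a * r"
  define Q where "Q = 1\<^sub>m a \<otimes>\<^sub>m q"
  have cq: "q \<in> carrier_mat r r" and cR: "\<rho> \<in> carrier_mat (a * r) (a * r)"
    using \<rho> q hermitian_matD by auto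
  have cR' [simp]: "\<rho> \<in> carrier_mat n n" using cR by (simp add: n_def)
  have cQ [simp]: "Q \<in> carrier_mat n n" using cq by (simp add: Q_def n_def)
  note assoc = assoc_mult_mat[of _ n n _ n _ n] mult_carrier_mat[of _ n n _ n]
    left_mult_one_mat[of _ n n] right_mult_one_mat[of _ n n]
  define Z where "Z = Q * \<rho> * Q"
  have cZ: "Z \<in> carrier_mat n n" unfolding Z_def by (intro mult_carrier_mat[of _ n n]) simp_all
  have Z: "Z $$ (i * r + c, j * r + c') =
      (\<Sum>e<r. \<Sum>e'<r. q $$ (c, e) * \<rho> $$ (i * r + e, j * r + e') * q $$ (e', c'))"
    if "i < a" "j < a" "c < r" "c' < r" for i j c c'
  proof -
    have "Z $$ (i * r + c, j * r + c') = (\<Sum>e'<r. (Q * \<rho>) $$ (i * r + c, j * r + e') * q $$ (e', c'))"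
      unfolding Z_def Q_def
      by (rule index_mult_tensor_one[OF cq mult_carrier_mat[OF tensor_one_carrier[OF cq] cR] that(2,4)
            mult_add_less_mult[OF that(1,3)]])
    also have "\<dots> = (\<Sum>e'<r. (\<Sum>e<r. q $$ (c, e) * \<rho> $$ (i * r + e, j * r + e')) * q $$ (e', c'))"
      unfolding Q_def using that
      by (intro sum.cong refl, subst index_tensor_one_mult[OF cq cR]) (auto simp: mult_add_less_mult)
    also have "\<dots> = (\<Sum>e'<r. \<Sum>e<r. q $$ (c, e) * \<rho> $$ (i * r + e, j * r + e') * q $$ (e', c'))"
      by (simp only: sum_distrib_right)
    finally show ?thesis by (subst sum.swap) (simp only:)
  qed
  have hZ: "hermitian_mat n Z"
  proof (rule hermitian_matI[OF cZ])
    fix p p' assume "p < n" "p' < n"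
    then obtain i c j c' where *: "i < a" "c < r" "p = i * r + c" "j < a" "c' < r" "p' = j * r + c'"
      unfolding n_def by (elim prod_index_cases) blast
    have "cnj (Z $$ (p, p')) =
        (\<Sum>e<r. \<Sum>e'<r. q $$ (e, c) * \<rho> $$ (j * r + e', i * r + e) * q $$ (c', e'))"
      using * unfolding *(3,6)
      by (simp add: Z hermitian_matD(2)[OF \<rho>] hermitian_matD(2)[OF q] mult_add_less_mult)
    also have "\<dots> = Z $$ (p', p)"
      unfolding *(3,6) Z[OF *(4,1,5,2)] by (subst sum.swap) (simp add: ac_simps)
    finally show "cnj (Z $$ (p, p')) = Z $$ (p', p)" .
  qed
  \<comment> \<open>Grouped so that moving \<open>\<rho> * Q\<close> cyclically to the right end
    leaves two equal factors \<open>Z\<close>.\<close>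
  have "\<rho> * S * \<rho> * S = (\<rho> * Q) * (Q * \<rho> * Q * Q)"
    by (simp add: S_def Q_def[symmetric] assoc)
  also have "mat_trace \<dots> = mat_trace ((Q * \<rho> * Q * Q) * (\<rho> * Q))"
    by (intro mat_trace_comm[of _ n n] mult_carrier_mat[of _ n n]) simp_all
  also have "(Q * \<rho> * Q * Q) * (\<rho> * Q) = Z * Z"
    by (simp add: Z_def assoc)
  also have "mat_trace (Z * Z) = of_real (\<Sum>p<n. \<Sum>p'<n. (cmod (Z $$ (p, p')))\<^sup>2)"
    by (rule mat_trace_hermitian_square[OF hZ])
  finally have "Re (mat_trace (\<rho> * S * \<rho> * S)) = (\<Sum>p<n. \<Sum>p'<n. (cmod (Z $$ (p, p')))\<^sup>2)"
    by (simp only: Re_complex_of_real)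
  also have "\<dots> = (\<Sum>i<a. \<Sum>c<r. \<Sum>j<a. \<Sum>c'<r. (cmod (Z $$ (i * r + c, j * r + c')))\<^sup>2)"
    by (simp only: n_def sum_lessThan_mult)
  also have "\<dots> = (\<Sum>c<r. \<Sum>i<a. \<Sum>c'<r. \<Sum>j<a. (cmod (Z $$ (i * r + c, j * r + c')))\<^sup>2)"
    by (subst sum.swap) (intro sum.cong refl sum.swap)
  also have "\<dots> = (\<Sum>c<r. \<Sum>c'<r. \<Sum>i<a. \<Sum>j<a. (cmod (Z $$ (i * r + c, j * r + c')))\<^sup>2)"
    by (intro sum.cong refl sum.swap)
  finally show ?thesis by (simp add: Z)
qed

subsection \<open>Maps in Kraus form\<close>

text \<open>The squared Hilbert-Schmidt norm. Matrices are plain functions of two indices here, so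
  that blocks of a larger matrix can be passed as lambda terms.\<close>

definition hs_sq :: "nat \<Rightarrow> (nat \<Rightarrow> nat \<Rightarrow> complex) \<Rightarrow> real" where
  "hs_sq n X = (\<Sum>a<n. \<Sum>b<n. (cmod (X a b))\<^sup>2)"

text \<open>The completely positive map with Kraus operators \<open>K \<kappa>\<close>. The output
  dimension is not fixed here but by the range of \<open>s\<close> and \<open>t\<close> at each
  use.\<close>

definition kraus_map ::
  "'k set \<Rightarrow> ('k \<Rightarrow> nat \<Rightarrow> nat \<Rightarrow> complex) \<Rightarrow> nat \<Rightarrow> (nat \<Rightarrow> nat \<Rightarrow> complex) \<Rightarrow> nat \<Rightarrow> nat \<Rightarrow> complex" where
  "kraus_map I K n X s t = (\<Sum>\<kappa>\<in>I. \<Sum>a<n. \<Sum>b<n. K \<kappa> s a * X a b * cnj (K \<kappa> t b))"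

lemma hs_sq_nonneg: "0 \<le> hs_sq n X"
  by (simp add: hs_sq_def sum_nonneg)

lemma hs_sq_cong:
  assumes "\<And>a b. a < n \<Longrightarrow> b < n \<Longrightarrow> X a b = Y a b"
  shows "hs_sq n X = hs_sq n Y"
  using assms by (simp add: hs_sq_def)

lemma hs_sq_eq_0_iff: "hs_sq n X = 0 \<longleftrightarrow> (\<forall>a<n. \<forall>b<n. X a b = 0)"
  by (auto simp: hs_sq_def sum_nonneg_eq_0_iff sum_nonneg)

lemma hs_sq_scale: "hs_sq n (\<lambda>a b. of_real c * X a b) = c\<^sup>2 * hs_sq n X"
  by (simp add: hs_sq_def norm_mult power_mult_distrib sum_distrib_left)

lemma hs_sq_diff:
  "hs_sq n (\<lambda>a b. X a b - Y a b) = hs_sq n X + hs_sq n Y - 2 * Re (\<Sum>a<n. \<Sum>b<n. X a b * cnj (Y a b))"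
proof -
  have "(cmod (u - w))\<^sup>2 = (cmod u)\<^sup>2 + (cmod w)\<^sup>2 - 2 * Re (u * cnj w)" for u w
    by (simp add: cmod_power2) (simp add: power2_eq_square algebra_simps)
  then show ?thesis
    by (simp only: hs_sq_def sum.distrib sum_subtractf sum_distrib_left Re_sum)
qed

text \<open>The inner product of two Hermitian matrices is real, so the cross term, twice its
  imaginary part, vanishes.\<close>

lemma hs_sq_add_ii:
  assumes X: "\<And>a b. a < n \<Longrightarrow> b < n \<Longrightarrow> cnj (X a b) = X b a"
    and Y: "\<And>a b. a < n \<Longrightarrow> b < n \<Longrightarrow> cnj (Y a b) = Y b a"
  shows "hs_sq n (\<lambda>a b. X a b + \<i> * Y a b) = hs_sq n X + hs_sq n Y"
proof -
  define S where "S = (\<Sum>a<n. \<Sum>b<n. X a b * cnj (Y a b))"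
  have "cnj S = (\<Sum>a<n. \<Sum>b<n. X b a * cnj (Y b a))"
    unfolding S_def cnj_sum complex_cnj_mult by (intro sum.cong refl) (simp add: X Y)
  also have "\<dots> = S" unfolding S_def by (rule sum.swap)
  finally have "Im S = 0" by (simp add: complex_eq_iff)
  have "(cmod (u + \<i> * w))\<^sup>2 = (cmod u)\<^sup>2 + (cmod w)\<^sup>2 + 2 * Im (u * cnj w)" for u w
    by (simp add: cmod_power2) (simp add: power2_eq_square algebra_simps)
  then have "hs_sq n (\<lambda>a b. X a b + \<i> * Y a b) = hs_sq n X + hs_sq n Y + 2 * Im S"
    by (simp only: hs_sq_def S_def sum.distrib sum_distrib_left Im_sum)
  with \<open>Im S = 0\<close> show ?thesis by simp
qed

lemma kraus_map_cong:
  assumes "\<And>a b. a < n \<Longrightarrow> b < n \<Longrightarrow> X a b = Y a b"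
  shows "kraus_map I K n X s t = kraus_map I K n Y s t"
  using assms by (simp add: kraus_map_def)

lemma kraus_map_diff:
  "kraus_map I K n (\<lambda>a b. X a b - Y a b) s t = kraus_map I K n X s t - kraus_map I K n Y s t"
  by (simp add: kraus_map_def algebra_simps sum_subtractf)

lemma kraus_map_add:
  "kraus_map I K n (\<lambda>a b. X a b + Y a b) s t = kraus_map I K n X s t + kraus_map I K n Y s t"
  by (simp add: kraus_map_def algebra_simps sum.distrib)

lemma kraus_map_scale: "kraus_map I K n (\<lambda>a b. c * X a b) s t = c * kraus_map I K n X s t"
  unfolding kraus_map_def sum_distrib_left by (intro sum.cong refl) (simp add: ac_simps)

lemma kraus_map_sum:
  assumes "finite E"
  shows "kraus_map I K n (\<lambda>a b. \<Sum>e\<in>E. X e a b) s t = (\<Sum>e\<in>E. kraus_map I K n (X e) s t)"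
  using assms
proof (induction E rule: finite_induct)
  case empty
  then show ?case by (simp add: kraus_map_def)
qed (simp add: kraus_map_add)

lemma cnj_kraus_map: "cnj (kraus_map I K n X s t) = kraus_map I K n (\<lambda>a b. cnj (X b a)) t s"
  unfolding kraus_map_def cnj_sum complex_cnj_mult complex_cnj_cnj
  by (subst (2) sum.swap) (intro sum.cong refl, simp add: ac_simps)

text \<open>A rank-one term is sent to rank-one terms, \<open>K \<kappa>\<close> acting on the
  vector \<open>u j\<close>. Images of Gram matrices are thus Gram matrices again, which is the
  positivity needed for the cross term below.\<close>

lemma kraus_map_gram:
  assumes "finite I" "finite J"
  shows "kraus_map I K n (\<lambda>a b. \<Sum>j\<in>J. u j a * cnj (u j b)) s t =
    (\<Sum>(\<kappa>, j)\<in>I \<times> J. (\<Sum>a<n. K \<kappa> s a * u j a) * cnj (\<Sum>b<n. K \<kappa> t b * u j b))"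
proof -
  have "kraus_map I K n (\<lambda>a b. u j a * cnj (u j b)) s t =
      (\<Sum>\<kappa>\<in>I. (\<Sum>a<n. K \<kappa> s a * u j a) * cnj (\<Sum>b<n. K \<kappa> t b * u j b))" for j
    unfolding kraus_map_def cnj_sum sum_product complex_cnj_mult
    by (intro sum.cong refl) (simp add: ac_simps)
  then show ?thesis
    using assms by (simp add: kraus_map_sum sum.cartesian_product[symmetric] sum.swap[of _ I J])
qed

text \<open>The inner product of the rank-one matrices built from \<open>u i\<close> and
  \<open>w j\<close> is the squared modulus of \<open><u i, w j>\<close>. The total is hence
  nonnegative, and zero when every \<open>u i\<close> is orthogonal to every
  \<open>w j\<close>.\<close>

lemma gram_inner_product:
  assumes "finite I" "finite J"
  shows "(\<Sum>s<p. \<Sum>t<p. (\<Sum>i\<in>I. u i s * cnj (u i t)) * cnj (\<Sum>j\<in>J. w j s * cnj (w j t))) =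
    complex_of_real (\<Sum>i\<in>I. \<Sum>j\<in>J. (cmod (\<Sum>s<p. u i s * cnj (w j s)))\<^sup>2)"
proof -
  have "(\<Sum>s<p. \<Sum>t<p. (\<Sum>i\<in>I. u i s * cnj (u i t)) * cnj (\<Sum>j\<in>J. w j s * cnj (w j t))) =
      (\<Sum>s<p. \<Sum>t<p. \<Sum>i\<in>I. \<Sum>j\<in>J. (u i s * cnj (w j s)) * cnj (u i t * cnj (w j t)))"
    unfolding cnj_sum sum_product by (intro sum.cong refl) (simp add: ac_simps)
  also have "\<dots> = (\<Sum>s<p. \<Sum>i\<in>I. \<Sum>t<p. \<Sum>j\<in>J. (u i s * cnj (w j s)) * cnj (u i t * cnj (w j t)))"
    by (intro sum.cong refl sum.swap)
  also have "\<dots> = (\<Sum>i\<in>I. \<Sum>s<p. \<Sum>t<p. \<Sum>j\<in>J. (u i s * cnj (w j s)) * cnj (u i t * cnj (w j t)))"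
    by (rule sum.swap)
  also have "\<dots> = (\<Sum>i\<in>I. \<Sum>s<p. \<Sum>j\<in>J. \<Sum>t<p. (u i s * cnj (w j s)) * cnj (u i t * cnj (w j t)))"
    by (intro sum.cong refl sum.swap)
  also have "\<dots> = (\<Sum>i\<in>I. \<Sum>j\<in>J. \<Sum>s<p. \<Sum>t<p. (u i s * cnj (w j s)) * cnj (u i t * cnj (w j t)))"
    by (intro sum.cong refl sum.swap)
  also have "\<dots> = (\<Sum>i\<in>I. \<Sum>j\<in>J. (\<Sum>s<p. u i s * cnj (w j s)) * cnj (\<Sum>s<p. u i s * cnj (w j s)))"
    unfolding cnj_sum sum_product by (rule refl)
  finally show ?thesis by (simp only: of_real_sum complex_norm_square)
qed

lemma psd_mat_gram:
  assumes "finite I"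
  shows "psd_mat n (mat n n (\<lambda>(a, b). \<Sum>i\<in>I. u i a * cnj (u i b)))"
  unfolding psd_mat_iff
proof (intro conjI allI)
  fix f :: "nat \<Rightarrow> complex"
  \<comment> \<open>The quadratic form at \<open>f\<close> is the inner product with the rank-one
    matrix of \<open>f\<close>, written as a Gram matrix over a one-element index set.\<close>
  have "(\<Sum>a<n. \<Sum>b<n. mat n n (\<lambda>(a, b). \<Sum>i\<in>I. u i a * cnj (u i b)) $$ (a, b) * f b * cnj (f a)) =
      (\<Sum>a<n. \<Sum>b<n. (\<Sum>i\<in>I. u i a * cnj (u i b)) * cnj (\<Sum>j\<in>{()}. f a * cnj (f b)))"
    by (intro sum.cong refl) (simp add: ac_simps)
  also have "\<dots> = complex_of_real (\<Sum>i\<in>I. \<Sum>j\<in>{()}. (cmod (\<Sum>a<n. u i a * cnj (f a)))\<^sup>2)"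
    using gram_inner_product[OF assms, of "{()}" u "\<lambda>_. f" n] by simp
  finally show "0 \<le> (\<Sum>a<n. \<Sum>b<n. mat n n (\<lambda>(a, b). \<Sum>i\<in>I. u i a * cnj (u i b)) $$ (a, b) * f b * cnj (f a))"
    by (simp add: less_eq_complex_def sum_nonneg)
qed simp

text \<open>The positive and negative parts are Gram matrices \<open>P\<close> and \<open>M\<close>.
  Their inner product vanishes, so the norms add on the right-hand side; the inner product of the
  images is nonnegative and enters with a minus sign, so the left-hand side is at most the
  sum.\<close>

lemma kraus_map_hermitian_bound:
  assumes I: "finite I"
    and bound: "\<And>X. psd_mat n X \<Longrightarrow>
      hs_sq p (kraus_map I K n (\<lambda>a b. X $$ (a, b))) \<le> C * hs_sq n (\<lambda>a b. X $$ (a, b))"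
    and H: "\<And>a b. a < n \<Longrightarrow> b < n \<Longrightarrow> cnj (H a b) = H b a"
  shows "hs_sq p (kraus_map I K n H) \<le> C * hs_sq n H"
proof -
  have "hermitian_mat n (mat n n (\<lambda>(a, b). H a b))"
    by (rule hermitian_matI) (simp_all add: H)
  then obtain V l where V: "unitary_mat n V"
    and HV: "mat n n (\<lambda>(a, b). H a b) = V * mat_diag n (\<lambda>i. complex_of_real (l i)) * mat_adjoint V"
    by (rule hermitian_mat_spectral)
  have cV: "V \<in> carrier_mat n n" "mat_adjoint V \<in> carrier_mat n n" using V by (simp_all add: unitary_mat_def)
  have orth: "(\<Sum>a<n. V $$ (a, i) * cnj (V $$ (a, j))) = (if i = j then 1 else 0)" if "i < n" "j < n" for i j
  proof -
    have "(mat_adjoint V * V) $$ (j, i) = (if i = j then 1 else 0)"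
      using V that by (simp add: unitary_mat_def)
    moreover have "(mat_adjoint V * V) $$ (j, i) = (\<Sum>a<n. V $$ (a, i) * cnj (V $$ (a, j)))"
      unfolding index_mult_mat_sum[OF cV(2) cV(1) that(2,1)]
      using cV that by (intro sum.cong refl) simp
    ultimately show ?thesis by simp
  qed
  \<comment> \<open>Eigenvectors scaled by the square roots of the positive and, for
    \<open>w\<close>, the negative parts of the eigenvalues.\<close>
  define u where "u i a = complex_of_real (sqrt (max 0 (l i))) * V $$ (a, i)" for i a
  define w where "w i a = complex_of_real (sqrt (max 0 (- l i))) * V $$ (a, i)" for i a
  define P where "P a b = (\<Sum>i<n. u i a * cnj (u i b))" for a b
  define M where "M a b = (\<Sum>i<n. w i a * cnj (w i b))" for a b
  have uu: "u i a * cnj (u i b) = complex_of_real (max 0 (l i)) * (V $$ (a, i) * cnj (V $$ (b, i)))" for i a b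
    unfolding u_def complex_cnj_mult complex_cnj_complex_of_real
    using of_real_mult[of "sqrt (max 0 (l i))" "sqrt (max 0 (l i))", where 'a = complex]
    by (simp add: ac_simps)
  have ww: "w i a * cnj (w i b) = complex_of_real (max 0 (- l i)) * (V $$ (a, i) * cnj (V $$ (b, i)))" for i a b
    unfolding w_def complex_cnj_mult complex_cnj_complex_of_real
    using of_real_mult[of "sqrt (max 0 (- l i))" "sqrt (max 0 (- l i))", where 'a = complex]
    by (simp add: ac_simps)
  have HPM: "H a b = P a b - M a b" if "a < n" "b < n" for a b
  proof -
    have "H a b = (\<Sum>i<n. V $$ (a, i) * complex_of_real (l i) * cnj (V $$ (b, i)))"
      using arg_cong[OF HV, of "\<lambda>A. A $$ (a, b)"] that by (simp add: index_spectral_mat[OF cV(1)])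
    also have "\<dots> = P a b - M a b"
      unfolding P_def M_def sum_subtractf[symmetric] uu ww
    proof (intro sum.cong refl)
      fix i
      have "complex_of_real (l i) = complex_of_real (max 0 (l i)) - complex_of_real (max 0 (- l i))"
        by (simp add: max_def)
      then show "V $$ (a, i) * complex_of_real (l i) * cnj (V $$ (b, i)) =
          complex_of_real (max 0 (l i)) * (V $$ (a, i) * cnj (V $$ (b, i))) -
          complex_of_real (max 0 (- l i)) * (V $$ (a, i) * cnj (V $$ (b, i)))"
        by (simp only: left_diff_distrib right_diff_distrib ac_simps)
    qed
    finally show ?thesis .
  qed
  have "hs_sq p (kraus_map I K n P) \<le> C * hs_sq n P"
    using bound[OF psd_mat_gram[of "{..<n}" n u]]
    by (simp add: P_def[symmetric] cong: hs_sq_cong kraus_map_cong)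
  moreover have "hs_sq p (kraus_map I K n M) \<le> C * hs_sq n M"
    using bound[OF psd_mat_gram[of "{..<n}" n w]]
    by (simp add: M_def[symmetric] cong: hs_sq_cong kraus_map_cong)
  moreover have "hs_sq n H = hs_sq n P + hs_sq n M"
  proof -
    \<comment> \<open>For distinct \<open>i\<close> and \<open>j\<close> the eigenvectors are
      orthogonal; for \<open>i = j\<close> one of the two parts of \<open>l i\<close> is
      zero.\<close>
    have "(\<Sum>a<n. u i a * cnj (w j a)) = 0" if "i < n" "j < n" for i j
    proof -
      have "(\<Sum>a<n. u i a * cnj (w j a)) = complex_of_real (sqrt (max 0 (l i)) * sqrt (max 0 (- l j))) *
          (\<Sum>a<n. V $$ (a, i) * cnj (V $$ (a, j)))"
        unfolding sum_distrib_left by (intro sum.cong refl) (simp add: u_def w_def ac_simps)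
      then show ?thesis unfolding orth[OF that] by (auto simp: max_def)
    qed
    then have "(\<Sum>a<n. \<Sum>b<n. P a b * cnj (M a b)) = 0"
      unfolding P_def M_def by (subst gram_inner_product) simp_all
    then show ?thesis
      using hs_sq_diff[of n P M] hs_sq_cong[of n H "\<lambda>a b. P a b - M a b"] HPM by simp
  qed
  moreover have "hs_sq p (kraus_map I K n H) \<le> hs_sq p (kraus_map I K n P) + hs_sq p (kraus_map I K n M)"
  proof -
    have "0 \<le> Re (\<Sum>s<p. \<Sum>t<p. kraus_map I K n P s t * cnj (kraus_map I K n M s t))"
      unfolding P_def M_def kraus_map_gram[OF I finite_lessThan] case_prod_unfold
      by (subst gram_inner_product) (simp_all add: I sum_nonneg)
    moreover have "kraus_map I K n H s t = kraus_map I K n P s t - kraus_map I K n M s t" for s t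
      unfolding kraus_map_diff[symmetric] by (rule kraus_map_cong) (rule HPM)
    ultimately show ?thesis
      using hs_sq_diff[of p "kraus_map I K n P" "kraus_map I K n M"]
        hs_sq_cong[of p "kraus_map I K n H" "\<lambda>s t. kraus_map I K n P s t - kraus_map I K n M s t"] by simp
  qed
  ultimately show ?thesis by (simp add: distrib_left)
qed

text \<open>The map sends Hermitian matrices to Hermitian ones, so \<open>hs_sq_add_ii\<close>
  splits the norm both of the argument and of the image along \<open>A + \<i> * B\<close>, and the
  two Hermitian bounds add up.\<close>

lemma kraus_map_bound:
  assumes I: "finite I"
    and bound: "\<And>X. psd_mat n X \<Longrightarrow>
      hs_sq p (kraus_map I K n (\<lambda>a b. X $$ (a, b))) \<le> C * hs_sq n (\<lambda>a b. X $$ (a, b))"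
  shows "hs_sq p (kraus_map I K n Y) \<le> C * hs_sq n Y"
proof -
  define A where "A a b = (Y a b + cnj (Y b a)) / 2" for a b
  define B where "B a b = \<i> * (cnj (Y b a) - Y a b) / 2" for a b
  have A: "cnj (A a b) = A b a" for a b by (simp add: A_def)
  have B: "cnj (B a b) = B b a" for a b by (simp add: B_def complex_eq_iff field_simps)
  have Y: "Y = (\<lambda>a b. A a b + \<i> * B a b)"
    by (intro ext) (simp add: A_def B_def complex_eq_iff field_simps)
  have "kraus_map I K n Y = (\<lambda>s t. kraus_map I K n A s t + \<i> * kraus_map I K n B s t)"
    by (intro ext) (simp only: Y kraus_map_add kraus_map_scale)
  then have "hs_sq p (kraus_map I K n Y) = hs_sq p (kraus_map I K n A) + hs_sq p (kraus_map I K n B)"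
    using hs_sq_add_ii[of p "kraus_map I K n A" "kraus_map I K n B"] by (simp add: cnj_kraus_map A B)
  also have "\<dots> \<le> C * hs_sq n A + C * hs_sq n B"
    by (intro add_mono kraus_map_hermitian_bound[OF I bound] A B)
  also have "\<dots> = C * hs_sq n Y"
    unfolding Y using hs_sq_add_ii[of n A B] A B by (simp add: distrib_left)
  finally show ?thesis .
qed

subsection \<open>The extractor map\<close>

text \<open>The Kraus operators of the extractor: apply \<open>U i\<close>, project the complement
  of \<open>M\<close> onto its basis vector \<open>j\<close>, record \<open>i\<close> in
  \<open>D\<close>, with weight \<open>1 / sqrt d\<close>. The index \<open>s\<close> of
  \<open>M \<otimes> D\<close> splits into \<open>s div d\<close> for \<open>M\<close> and
  \<open>s mod d\<close> for \<open>D\<close>.\<close>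

definition ext_kraus :: "nat \<Rightarrow> nat \<Rightarrow> (nat \<Rightarrow> complex mat) \<Rightarrow> nat \<times> nat \<Rightarrow> nat \<Rightarrow> nat \<Rightarrow> complex" where
  "ext_kraus x d U = (\<lambda>(i, j) s a.
     if s mod d = i then U i $$ (s div d * x + j, a) / of_real (sqrt (real d)) else 0)"

abbreviation ext_map :: "nat \<Rightarrow> nat \<Rightarrow> nat \<Rightarrow> (nat \<Rightarrow> complex mat) \<Rightarrow>
    (nat \<Rightarrow> nat \<Rightarrow> complex) \<Rightarrow> nat \<Rightarrow> nat \<Rightarrow> complex" where
  "ext_map m x d U \<equiv> kraus_map ({..<d} \<times> {..<x}) (ext_kraus x d U) (m * x)"

text \<open>The two weights multiply to \<open>1 / d\<close>, which brings the map into the shape of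
  the entries of \<open>ext_state\<close> and \<open>ext_state_side\<close>.\<close>

lemma ext_map_eq:
  assumes "d > 0"
  shows "ext_map m x d U X s t = 1 / of_nat d * (\<Sum>i<d. if s mod d = i \<and> t mod d = i then
      \<Sum>j<x. \<Sum>a<m * x. \<Sum>b<m * x.
        U i $$ (s div d * x + j, a) * X a b * cnj (U i $$ (t div d * x + j, b)) else 0)"
proof -
  have sq: "complex_of_real (sqrt (real d)) * complex_of_real (sqrt (real d)) = of_nat d"
    by (simp flip: of_real_mult)
  have "ext_map m x d U X s t = (\<Sum>i<d. \<Sum>j<x. \<Sum>a<m * x. \<Sum>b<m * x.
      ext_kraus x d U (i, j) s a * X a b * cnj (ext_kraus x d U (i, j) t b))"
    unfolding kraus_map_def sum.cartesian_product' by (rule refl)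
  also have "\<dots> = (\<Sum>i<d. 1 / of_nat d * (if s mod d = i \<and> t mod d = i then
      \<Sum>j<x. \<Sum>a<m * x. \<Sum>b<m * x.
        U i $$ (s div d * x + j, a) * X a b * cnj (U i $$ (t div d * x + j, b)) else 0))"
  proof (intro sum.cong refl)
    fix i
    show "(\<Sum>j<x. \<Sum>a<m * x. \<Sum>b<m * x.
        ext_kraus x d U (i, j) s a * X a b * cnj (ext_kraus x d U (i, j) t b)) =
      1 / of_nat d * (if s mod d = i \<and> t mod d = i then
      \<Sum>j<x. \<Sum>a<m * x. \<Sum>b<m * x.
        U i $$ (s div d * x + j, a) * X a b * cnj (U i $$ (t div d * x + j, b)) else 0)"
    proof (cases "s mod d = i \<and> t mod d = i")
      case True
      then show ?thesis
        by (simp only: simp_thms if_True sum_distrib_left ext_kraus_def case_prod_conv)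
          (intro sum.cong refl, simp add: sq[symmetric])
    qed (auto simp: ext_kraus_def)
  qed
  finally show ?thesis by (simp only: sum_distrib_left)
qed

lemma index_sandwich:
  assumes "A \<in> carrier_mat n n" "X \<in> carrier_mat n n" "p < n" "q < n"
  shows "(A * X * mat_adjoint A) $$ (p, q) = (\<Sum>a<n. \<Sum>b<n. A $$ (p, a) * X $$ (a, b) * cnj (A $$ (q, b)))"
proof -
  have "(A * X * mat_adjoint A) $$ (p, q) = (\<Sum>b<n. (A * X) $$ (p, b) * mat_adjoint A $$ (b, q))"
    using assms by (intro index_mult_mat_sum[of _ n n _ n] mult_carrier_mat[of _ n n] mat_adjoint_carrier)
  also have "\<dots> = (\<Sum>b<n. \<Sum>a<n. A $$ (p, a) * X $$ (a, b) * cnj (A $$ (q, b)))"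
    using assms by (intro sum.cong refl)
      (simp add: index_mult_mat_sum[of A n n X n] sum_distrib_right del: index_mult_mat)
  finally show ?thesis by (subst sum.swap) (simp only:)
qed

lemma index_ext_state:
  assumes "d > 0" and U: "\<And>i. i < d \<Longrightarrow> U i \<in> carrier_mat (m * x) (m * x)"
    and X: "X \<in> carrier_mat (m * x) (m * x)" and st: "s < m * d" "t < m * d"
  shows "ext_state m x d U X $$ (s, t) = ext_map m x d U (\<lambda>a b. X $$ (a, b)) s t"
proof -
  have div: "s div d < m" "t div d < m" using st by (simp_all add: less_mult_imp_div_less)
  have "(ptrace m x 1 (U i * X * mat_adjoint (U i)) \<otimes>\<^sub>m basis_proj d i) $$ (s, t) =
    (if s mod d = i \<and> t mod d = i then
      \<Sum>j<x. \<Sum>a<m * x. \<Sum>b<m * x.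
        U i $$ (s div d * x + j, a) * X $$ (a, b) * cnj (U i $$ (t div d * x + j, b)) else 0)"
    if "i < d" for i
    using st div \<open>d > 0\<close>
    by (simp add: tensor_mat_def basis_proj_def ptrace_def index_sandwich[OF U[OF that] X]
        mult_add_less_mult del: index_mult_mat)
  then show ?thesis
    using st by (simp add: ext_state_def mat_sum_def ext_map_eq[OF \<open>d > 0\<close>])
qed

lemma index_tensor_id:
  assumes "A \<in> carrier_mat n n" "p < n" "q < n" "c < r" "e < r"
  shows "(A \<otimes>\<^sub>m 1\<^sub>m r) $$ (p * r + c, q * r + e) = (if c = e then A $$ (p, q) else 0)"
  using assms by (simp add: tensor_mat_def mult_add_less_mult)

text \<open>The identity factor leaves the second index unchanged on either side, so only entries of
  \<open>X\<close> in the block \<open>c\<close>, \<open>c'\<close> survive.\<close>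

lemma index_sandwich_tensor_id:
  assumes A: "A \<in> carrier_mat n n" and X: "X \<in> carrier_mat (n * r) (n * r)"
    and "p < n" "q < n" "c < r" "c' < r"
  shows "((A \<otimes>\<^sub>m 1\<^sub>m r) * X * mat_adjoint (A \<otimes>\<^sub>m 1\<^sub>m r)) $$ (p * r + c, q * r + c') =
    (\<Sum>a<n. \<Sum>b<n. A $$ (p, a) * X $$ (a * r + c, b * r + c') * cnj (A $$ (q, b)))"
proof -
  have cA: "A \<otimes>\<^sub>m 1\<^sub>m r \<in> carrier_mat (n * r) (n * r)" using A by (auto simp: tensor_mat_def)
  have "((A \<otimes>\<^sub>m 1\<^sub>m r) * X * mat_adjoint (A \<otimes>\<^sub>m 1\<^sub>m r)) $$ (p * r + c, q * r + c') =
      (\<Sum>a<n. \<Sum>e<r. \<Sum>b<n. \<Sum>e'<r. (A \<otimes>\<^sub>m 1\<^sub>m r) $$ (p * r + c, a * r + e) *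
        X $$ (a * r + e, b * r + e') * cnj ((A \<otimes>\<^sub>m 1\<^sub>m r) $$ (q * r + c', b * r + e')))"
    using assms by (simp only: index_sandwich[OF cA X] mult_add_less_mult sum_lessThan_mult)
  also have "\<dots> = (\<Sum>a<n. \<Sum>e<r. \<Sum>b<n. \<Sum>e'<r. if e = c then if e' = c' then
      A $$ (p, a) * X $$ (a * r + e, b * r + e') * cnj (A $$ (q, b)) else 0 else 0)"
    using assms by (intro sum.cong refl) (auto simp: index_tensor_id)
  also have "\<dots> = (\<Sum>a<n. \<Sum>e<r. if e = c then \<Sum>b<n. \<Sum>e'<r. if e' = c' then
      A $$ (p, a) * X $$ (a * r + e, b * r + e') * cnj (A $$ (q, b)) else 0 else 0)"
    by (intro sum.cong refl) simp
  finally show ?thesis using assms by simp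
qed

text \<open>The extractor acts on each \<open>R\<close>-indexed block separately. Off-diagonal
  blocks need not be Hermitian, which is why the norm bound has to hold for arbitrary
  matrices.\<close>

lemma index_ext_state_side:
  assumes "d > 0" and U: "\<And>i. i < d \<Longrightarrow> U i \<in> carrier_mat (m * x) (m * x)"
    and X: "X \<in> carrier_mat (m * x * r) (m * x * r)"
    and st: "s < m * d" "t < m * d" and c: "c < r" "c' < r"
  shows "ext_state_side m x d r U X $$ (s * r + c, t * r + c') =
    ext_map m x d U (\<lambda>a b. X $$ (a * r + c, b * r + c')) s t"
proof -
  have div: "s div d < m" "t div d < m" using st by (simp_all add: less_mult_imp_div_less)
  have ind: "s * r + c < m * d * r" "t * r + c' < m * d * r" using st c by (simp_all add: mult_add_less_mult)
  \<comment> \<open>In the order \<open>M \<otimes> D \<otimes> R\<close>, dividing by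
    \<open>d * r\<close> removes the indices of both \<open>D\<close> and \<open>R\<close>.\<close>
  have quot: "(s * r + c) div (d * r) = s div d" "(t * r + c') div (d * r) = t div d"
    using c by (simp_all add: mult.commute[of d] div_mult2_eq)
  have "tensor_mid m d r (ptrace m x r ((U i \<otimes>\<^sub>m 1\<^sub>m r) * X * mat_adjoint (U i \<otimes>\<^sub>m 1\<^sub>m r)))
      (basis_proj d i) $$ (s * r + c, t * r + c') =
    (if s mod d = i \<and> t mod d = i then
      \<Sum>j<x. \<Sum>a<m * x. \<Sum>b<m * x.
        U i $$ (s div d * x + j, a) * X $$ (a * r + c, b * r + c') * cnj (U i $$ (t div d * x + j, b)) else 0)"
    if "i < d" for i
    using c div ind \<open>d > 0\<close>
    by (simp add: tensor_mid_def quot basis_proj_def ptrace_def index_sandwich_tensor_id[OF U[OF that] X]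
        mult_add_less_mult del: index_mult_mat)
  then show ?thesis
    using ind by (simp add: ext_state_side_def mat_sum_def ext_map_eq[OF \<open>d > 0\<close>])
qed

text \<open>Orthonormality of the columns of \<open>U i\<close> makes each conjugation preserve the
  trace, hence also the average. The matrix \<open>X\<close> is arbitrary, so that the result
  applies to blocks.\<close>

lemma ext_map_trace:
  assumes "d > 0" and U: "\<And>i. i < d \<Longrightarrow> unitary_mat (m * x) (U i)"
  shows "(\<Sum>s<m * d. ext_map m x d U X s s) = (\<Sum>a<m * x. X a a)"
proof -
  define n where "n = m * x"
  have key: "(\<Sum>q<n. \<Sum>a<n. \<Sum>b<n. U i $$ (q, a) * X a b * cnj (U i $$ (q, b))) = (\<Sum>a<n. X a a)"
    if "i < d" for i
  proof -
    have u: "unitary_mat n (U i)" using U[OF that] by (simp add: n_def)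
    have cU: "U i \<in> carrier_mat n n" "mat_adjoint (U i) \<in> carrier_mat n n"
      using u by (simp_all add: unitary_mat_def)
    have orth: "(\<Sum>q<n. U i $$ (q, a) * cnj (U i $$ (q, b))) = (if b = a then 1 else 0)"
      if "a < n" "b < n" for a b
    proof -
      have "(mat_adjoint (U i) * U i) $$ (b, a) = (if b = a then 1 else 0)"
        using u that by (simp add: unitary_mat_def)
      moreover have "(mat_adjoint (U i) * U i) $$ (b, a) = (\<Sum>q<n. U i $$ (q, a) * cnj (U i $$ (q, b)))"
        unfolding index_mult_mat_sum[OF cU(2) cU(1) that(2,1)]
        using cU that by (intro sum.cong refl) simp
      ultimately show ?thesis by simp
    qed
    have "(\<Sum>q<n. \<Sum>a<n. \<Sum>b<n. U i $$ (q, a) * X a b * cnj (U i $$ (q, b))) =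
        (\<Sum>a<n. \<Sum>q<n. \<Sum>b<n. U i $$ (q, a) * X a b * cnj (U i $$ (q, b)))"
      by (rule sum.swap)
    also have "\<dots> = (\<Sum>a<n. \<Sum>b<n. \<Sum>q<n. U i $$ (q, a) * X a b * cnj (U i $$ (q, b)))"
      by (intro sum.cong refl sum.swap)
    also have "\<dots> = (\<Sum>a<n. \<Sum>b<n. X a b * (\<Sum>q<n. U i $$ (q, a) * cnj (U i $$ (q, b))))"
      unfolding sum_distrib_left by (intro sum.cong refl) (simp add: ac_simps)
    also have "\<dots> = (\<Sum>a<n. \<Sum>b<n. if b = a then X a b else 0)"
      by (intro sum.cong refl) (simp add: orth)
    finally show ?thesis by simp
  qed
  have "(\<Sum>s<m * d. ext_map m x d U X s s) = (\<Sum>p<m. \<Sum>i<d. 1 / of_nat d *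
      (\<Sum>j<x. \<Sum>a<n. \<Sum>b<n. U i $$ (p * x + j, a) * X a b * cnj (U i $$ (p * x + j, b))))"
    unfolding sum_lessThan_mult
    by (intro sum.cong refl) (simp add: ext_map_eq[OF \<open>d > 0\<close>] n_def)
  \<comment> \<open>The index \<open>p\<close> of \<open>M\<close> and the traced-out
    \<open>j\<close> together form the full index \<open>q\<close> of \<open>N\<close>.\<close>
  also have "\<dots> = (\<Sum>i<d. 1 / of_nat d *
      (\<Sum>q<n. \<Sum>a<n. \<Sum>b<n. U i $$ (q, a) * X a b * cnj (U i $$ (q, b))))"
    by (subst sum.swap) (simp add: n_def sum_lessThan_mult[of _ m x] sum_distrib_left)
  also have "\<dots> = (\<Sum>i<d. 1 / of_nat d * (\<Sum>a<n. X a a))"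
    by (rule sum.cong[OF refl]) (simp only: key lessThan_iff)
  finally show ?thesis using \<open>d > 0\<close> by (simp add: n_def)
qed

section \<open>Entropy bounds as norm inequalities\<close>

lemma neg_log2_ge_iff:
  assumes "0 \<le> v" "0 < c"
  shows "ereal (log 2 c) \<le> neg_log2 v \<longleftrightarrow> c * v \<le> 1"
proof (cases "v = 0")
  case False
  then have "v > 0" using assms by simp
  have "log 2 c \<le> - log 2 v \<longleftrightarrow> log 2 (c * v) \<le> log 2 1"
    using \<open>v > 0\<close> assms by (simp add: log_mult) linarith
  also have "\<dots> \<longleftrightarrow> c * v \<le> 1" using \<open>v > 0\<close> assms by (subst log_le_cancel_iff) auto
  finally show ?thesis using False by (simp add: neg_log2_def)
\<comment> \<open>For \<open>v = 0\<close> the entropy is infinite and both sides hold.\<close>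
qed (simp add: neg_log2_def)

text \<open>The extractor property ranges over all positive semi-definite operators, not just
  normalised ones. A nonzero \<open>X\<close> can therefore be rescaled to have entropy exactly
  \<open>k\<close>; both norms are quadratic in the scaling, which cancels.\<close>

lemma extractor_psd_bound:
  assumes d: "d > 0" and "m > 0" "\<epsilon> > 0" and U: "\<And>i. i < d \<Longrightarrow> U i \<in> carrier_mat (m * x) (m * x)"
    and ext: "strong_renyi2_extractor m x d k \<epsilon> U" and X: "psd_mat (m * x) X"
  shows "hs_sq (m * d) (ext_map m x d U (\<lambda>a b. X $$ (a, b))) \<le>
    2 powr k * ((\<epsilon> + 1) / (real m * real d)) * hs_sq (m * x) (\<lambda>a b. X $$ (a, b))"
proof (cases "hs_sq (m * x) (\<lambda>a b. X $$ (a, b)) = 0")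
  case True
  then have "ext_map m x d U (\<lambda>a b. X $$ (a, b)) s t = 0" for s t
    by (simp add: hs_sq_eq_0_iff kraus_map_def)
  then show ?thesis using True by (simp add: hs_sq_def)
next
  case False
  define h where "h = hs_sq (m * x) (\<lambda>a b. X $$ (a, b))"
  have h: "h > 0" using False hs_sq_nonneg[of "m * x" "\<lambda>a b. X $$ (a, b)"] by (simp add: h_def)
  \<comment> \<open>Chosen so that the squared norm of \<open>X'\<close> is
    \<open>2 powr (- k)\<close>.\<close>
  define g where "g = 1 / sqrt (2 powr k * h)"
  have g2: "g\<^sup>2 * (2 powr k * h) = 1" using h by (simp add: g_def power_divide)
  define X' where "X' = complex_of_real g \<cdot>\<^sub>m X"
  have cX: "X \<in> carrier_mat (m * x) (m * x)" using X by (simp add: psd_mat_def)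
  have iX': "X' $$ (a, b) = complex_of_real g * X $$ (a, b)" if "a < m * x" "b < m * x" for a b
    using that cX by (simp add: X'_def)
  have X': "psd_mat (m * x) X'"
    unfolding psd_mat_iff
  proof (intro conjI allI)
    show cX': "X' \<in> carrier_mat (m * x) (m * x)" using cX by (simp add: X'_def)
    fix f :: "nat \<Rightarrow> complex"
    have "(\<Sum>i<m * x. \<Sum>j<m * x. X' $$ (i, j) * f j * cnj (f i)) =
        complex_of_real g * (\<Sum>i<m * x. \<Sum>j<m * x. X $$ (i, j) * f j * cnj (f i))"
      unfolding sum_distrib_left by (intro sum.cong refl) (simp add: iX')
    also have "0 \<le> \<dots>"
    proof (rule mult_nonneg_nonneg)
      show "0 \<le> complex_of_real g" using h by (simp add: g_def less_eq_complex_def)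
    qed (use X psd_mat_iff in blast)
    finally show "0 \<le> (\<Sum>i<m * x. \<Sum>j<m * x. X' $$ (i, j) * f j * cnj (f i))" .
  qed
  then have hX': "hermitian_mat (m * x) X'" by (rule psd_mat_hermitian)
  have cX': "X' \<in> carrier_mat (m * x) (m * x)" using X' by (simp add: psd_mat_def)
  have "Re (mat_trace (X' * X')) = hs_sq (m * x) (\<lambda>a b. X' $$ (a, b))"
    unfolding mat_trace_hermitian_square[OF hX'] hs_sq_def by (rule Re_complex_of_real)
  also have "\<dots> = g\<^sup>2 * h"
    unfolding h_def hs_sq_scale[symmetric] by (rule hs_sq_cong) (rule iX')
  finally have tr: "Re (mat_trace (X' * X')) = g\<^sup>2 * h" .
  have "ereal (log 2 (2 powr k)) \<le> H2 X'"
    unfolding H2_def tr using h g2 by (subst neg_log2_ge_iff) (auto simp: algebra_simps)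
  then have H: "ereal (log 2 (real m * real d / (\<epsilon> + 1))) \<le> H2 (ext_state m x d U X')"
    using ext X' by (simp add: strong_renyi2_extractor_def)
  let ?T = "ext_state m x d U X'"
  have T: "?T $$ (s, t) = ext_map m x d U (\<lambda>a b. X' $$ (a, b)) s t" if "s < m * d" "t < m * d" for s t
    by (rule index_ext_state[OF d U cX' that])
  have hT: "hermitian_mat (m * d) ?T"
  proof (rule hermitian_matI)
    show "?T \<in> carrier_mat (m * d) (m * d)" by (simp add: ext_state_def mat_sum_def)
    fix s t assume "s < m * d" "t < m * d"
    then show "cnj (?T $$ (s, t)) = ?T $$ (t, s)"
      by (simp add: T cnj_kraus_map hermitian_matD(2)[OF hX'] cong: kraus_map_cong)
  qed
  have "Re (mat_trace (?T * ?T)) = hs_sq (m * d) (\<lambda>s t. ?T $$ (s, t))"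
    unfolding mat_trace_hermitian_square[OF hT] hs_sq_def by (rule Re_complex_of_real)
  also have "\<dots> = hs_sq (m * d) (\<lambda>s t. complex_of_real g * ext_map m x d U (\<lambda>a b. X $$ (a, b)) s t)"
    by (rule hs_sq_cong) (simp add: T iX' kraus_map_scale[symmetric] cong: kraus_map_cong)
  finally have trT: "Re (mat_trace (?T * ?T)) = g\<^sup>2 * hs_sq (m * d) (ext_map m x d U (\<lambda>a b. X $$ (a, b)))"
    unfolding hs_sq_scale .
  define h' where "h' = hs_sq (m * d) (ext_map m x d U (\<lambda>a b. X $$ (a, b)))"
  have "real m * real d / (\<epsilon> + 1) * (g\<^sup>2 * h') \<le> 1"
    using H unfolding H2_def trT h'_def[symmetric]
    by (subst (asm) neg_log2_ge_iff) (use assms hs_sq_nonneg in \<open>auto simp: h'_def\<close>)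
  \<comment> \<open>Multiplying by \<open>2 powr k * h\<close>, the inverse of
    \<open>g\<^sup>2\<close>, removes the scaling.\<close>
  then have "real m * real d / (\<epsilon> + 1) * (g\<^sup>2 * h') * (2 powr k * h) \<le> 1 * (2 powr k * h)"
    using h by (intro mult_right_mono) auto
  also have "real m * real d / (\<epsilon> + 1) * (g\<^sup>2 * h') * (2 powr k * h) =
      real m * real d / (\<epsilon> + 1) * h' * (g\<^sup>2 * (2 powr k * h))" by (simp only: ac_simps)
  finally have "real m * real d / (\<epsilon> + 1) * h' \<le> 2 powr k * h" unfolding g2 by simp
  then show ?thesis
    using assms(1-3) unfolding h_def[symmetric] h'_def[symmetric] by (simp add: field_simps)
qed

section \<open>Extractors with side information\<close>

lemma index_ptrace_first:
  assumes "c < r" "c' < r"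
  shows "ptrace 1 n r \<rho> $$ (c, c') = (\<Sum>j<n. \<rho> $$ (j * r + c, j * r + c'))"
  using assms by (simp add: ptrace_def)

text \<open>The quadratic form of the marginal at \<open>f\<close> is the sum over \<open>j\<close>
  of the form of \<open>\<rho>\<close> at \<open>|j> \<otimes> f\<close>; the function
  \<open>g j\<close> in the proof is this vector.\<close>

lemma psd_mat_ptrace_first:
  assumes "psd_mat (n * r) \<rho>"
  shows "psd_mat r (ptrace 1 n r \<rho>)"
  unfolding psd_mat_iff
proof (intro conjI allI)
  fix f :: "nat \<Rightarrow> complex"
  define g where "g j p = (if p div r = j then f (p mod r) else 0)" for j p
  have block: "(\<Sum>p<n * r. \<Sum>q<n * r. \<rho> $$ (p, q) * g j q * cnj (g j p)) =
      (\<Sum>c<r. \<Sum>c'<r. \<rho> $$ (j * r + c, j * r + c') * f c' * cnj (f c))" if "j < n" for j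
  proof -
    have "(\<Sum>p<n * r. \<Sum>q<n * r. \<rho> $$ (p, q) * g j q * cnj (g j p)) =
        (\<Sum>i<n. \<Sum>c<r. \<Sum>i'<n. \<Sum>c'<r. \<rho> $$ (i * r + c, i' * r + c') * g j (i' * r + c') * cnj (g j (i * r + c)))"
      by (simp only: sum_lessThan_mult)
    also have "\<dots> = (\<Sum>i<n. \<Sum>c<r. \<Sum>i'<n. \<Sum>c'<r. if i' = j then if i = j then
        \<rho> $$ (i * r + c, i' * r + c') * f c' * cnj (f c) else 0 else 0)"
      by (intro sum.cong refl) (simp add: g_def)
    also have "\<dots> = (\<Sum>i<n. \<Sum>c<r. \<Sum>i'<n. if i' = j then \<Sum>c'<r. if i = j then
        \<rho> $$ (i * r + c, i' * r + c') * f c' * cnj (f c) else 0 else 0)"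
      by (intro sum.cong refl) simp
    also have "\<dots> = (\<Sum>i<n. if i = j then \<Sum>c<r. \<Sum>c'<r.
        \<rho> $$ (i * r + c, j * r + c') * f c' * cnj (f c) else 0)"
      using that by (intro sum.cong refl) simp
    finally show ?thesis using that by simp
  qed
  have "(\<Sum>c<r. \<Sum>c'<r. ptrace 1 n r \<rho> $$ (c, c') * f c' * cnj (f c)) =
      (\<Sum>c<r. \<Sum>c'<r. \<Sum>j<n. \<rho> $$ (j * r + c, j * r + c') * f c' * cnj (f c))"
    by (intro sum.cong refl) (simp only: index_ptrace_first lessThan_iff sum_distrib_right)
  also have "\<dots> = (\<Sum>c<r. \<Sum>j<n. \<Sum>c'<r. \<rho> $$ (j * r + c, j * r + c') * f c' * cnj (f c))"
    by (intro sum.cong refl sum.swap)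
  also have "\<dots> = (\<Sum>j<n. \<Sum>c<r. \<Sum>c'<r. \<rho> $$ (j * r + c, j * r + c') * f c' * cnj (f c))"
    by (rule sum.swap)
  also have "\<dots> = (\<Sum>j<n. \<Sum>p<n * r. \<Sum>q<n * r. \<rho> $$ (p, q) * g j q * cnj (g j p))"
    by (rule sum.cong[OF refl]) (simp only: block lessThan_iff)
  also have "0 \<le> \<dots>"
    by (rule sum_nonneg) (use assms in \<open>unfold psd_mat_iff, elim conjE allE\<close>)
  finally show "0 \<le> (\<Sum>c<r. \<Sum>c'<r. ptrace 1 n r \<rho> $$ (c, c') * f c' * cnj (f c))" .
qed (simp add: ptrace_def)

lemma hermitian_ext_state_side:
  assumes "d > 0" and U: "\<And>i. i < d \<Longrightarrow> U i \<in> carrier_mat (m * x) (m * x)"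
    and \<rho>: "hermitian_mat (m * x * r) \<rho>"
  shows "hermitian_mat (m * d * r) (ext_state_side m x d r U \<rho>)"
proof (rule hermitian_matI)
  show "ext_state_side m x d r U \<rho> \<in> carrier_mat (m * d * r) (m * d * r)"
    by (simp add: ext_state_side_def mat_sum_def)
  fix p q assume p: "p < m * d * r" and q: "q < m * d * r"
  obtain s c where s: "s < m * d" "c < r" "p = s * r + c" by (rule prod_index_cases[OF p])
  obtain t c' where t: "t < m * d" "c' < r" "q = t * r + c'" by (rule prod_index_cases[OF q])
  have ind: "ext_state_side m x d r U \<rho> $$ (s * r + c, t * r + c') =
      ext_map m x d U (\<lambda>a b. \<rho> $$ (a * r + c, b * r + c')) s t"
    if "s < m * d" "t < m * d" "c < r" "c' < r" for s t c c'
    using that by (intro index_ext_state_side[OF assms(1) U hermitian_matD(1)[OF \<rho>]])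
  show "cnj (ext_state_side m x d r U \<rho> $$ (p, q)) = ext_state_side m x d r U \<rho> $$ (q, p)"
    unfolding s(3) t(3) ind[OF s(1) t(1) s(2) t(2)] ind[OF t(1) s(1) t(2) s(2)] cnj_kraus_map
    by (rule kraus_map_cong) (use s t in \<open>simp add: hermitian_matD(2)[OF \<rho>] mult_add_less_mult\<close>)
qed

theorem theorem4p23:
  fixes m x d :: nat and k \<epsilon> :: real and U :: "nat \<Rightarrow> complex mat"
  assumes "m > 0" and "x > 0" and "d > 0"
    and "0 \<le> k" and "k \<le> log 2 (real (m * x))"
    and "\<epsilon> > 0"
    and "\<And>i. i < d \<Longrightarrow> unitary_mat (m * x) (U i)"
    and "strong_renyi2_extractor m x d k \<epsilon> U"
  shows "strong_renyi2_extractor_side_info m x d k \<epsilon> U"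
  unfolding strong_renyi2_extractor_side_info_def
proof (intro allI impI, elim conjE)
  fix r \<rho>
  assume psd: "psd_mat (m * x * r) \<rho>" and Hk: "ereal k \<le> H2_cond (m * x) r \<rho>"
  define T where "T = ext_map m x d U"
  define \<sigma> where "\<sigma> = ext_state_side m x d r U \<rho>"
  \<comment> \<open>The factor \<open>2 powr k\<close> compensates the bound
    \<open>2 powr (- k)\<close> on the input norm; the rest is the norm allowed for the
    output.\<close>
  define C where "C = 2 powr k * ((\<epsilon> + 1) / (real m * real d))"
  have U: "U i \<in> carrier_mat (m * x) (m * x)" if "i < d" for i
    using assms(7)[OF that] by (simp add: unitary_mat_def)
  have h\<rho>: "hermitian_mat (m * x * r) \<rho>" by (rule psd_mat_hermitian[OF psd])
  have h\<sigma>: "hermitian_mat (m * d * r) \<sigma>"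
    unfolding \<sigma>_def by (rule hermitian_ext_state_side[OF assms(3) U h\<rho>])
  have \<sigma>: "\<sigma> $$ (s * r + c, t * r + c') = T (\<lambda>a b. \<rho> $$ (a * r + c, b * r + c')) s t"
    if "s < m * d" "t < m * d" "c < r" "c' < r" for s t c c'
    unfolding \<sigma>_def T_def using that
    by (intro index_ext_state_side[OF assms(3) U hermitian_matD(1)[OF h\<rho>]])
  have contraction: "hs_sq (m * d) (T Y) \<le> C * hs_sq (m * x) Y" for Y
    unfolding T_def C_def
    by (rule kraus_map_bound, simp, rule extractor_psd_bound[OF assms(3,1,6) U assms(8)])
  \<comment> \<open>Entry \<open>(c, c')\<close> of a marginal is the trace of the block
    \<open>c\<close>, \<open>c'\<close>, and \<open>T\<close> preserves traces.\<close>
  have marginal: "ptrace 1 (m * d) r \<sigma> = ptrace 1 (m * x) r \<rho>"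
  proof (rule eq_matI)
    fix c c' assume "c < dim_row (ptrace 1 (m * x) r \<rho>)" "c' < dim_col (ptrace 1 (m * x) r \<rho>)"
    then have c: "c < r" "c' < r" by (simp_all add: ptrace_def)
    show "ptrace 1 (m * d) r \<sigma> $$ (c, c') = ptrace 1 (m * x) r \<rho> $$ (c, c')"
      unfolding index_ptrace_first[OF c]
      using ext_map_trace[of d m x U "\<lambda>a b. \<rho> $$ (a * r + c, b * r + c')", OF assms(3,7)] c
      by (simp add: \<sigma> T_def)
  qed (simp_all add: ptrace_def)
  \<comment> \<open>The same \<open>q\<close> serves for the dimensions \<open>m * x\<close> and
    \<open>m * d\<close>, because it is chosen from the common marginal before
    \<open>a\<close>.\<close>
  obtain q where q: "hermitian_mat r q"
    and S: "\<And>a. inv_sqrt_mat (1\<^sub>m a \<otimes>\<^sub>m ptrace 1 (m * x) r \<rho>) = (1\<^sub>m a \<otimes>\<^sub>m q) * (1\<^sub>m a \<otimes>\<^sub>m q)"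
    using inv_sqrt_tensor_one_psd[OF psd_mat_ptrace_first[OF psd]] by blast
  \<comment> \<open>The block \<open>c\<close>, \<open>c'\<close> of \<open>\<rho>\<close> after
    conjugation with \<open>1 \<otimes> q\<close>.\<close>
  define Y where "Y c c' a b = (\<Sum>e<r. \<Sum>e'<r. q $$ (c, e) * \<rho> $$ (a * r + e, b * r + e') * q $$ (e', c'))"
    for c c' a b
  define h where "h = (\<Sum>c<r. \<Sum>c'<r. hs_sq (m * x) (Y c c'))"
  define h' where "h' = (\<Sum>c<r. \<Sum>c'<r. hs_sq (m * d) (T (Y c c')))"
  have \<rho>_entropy: "H2_cond (m * x) r \<rho> = neg_log2 h"
    unfolding H2_cond_def Let_def S mat_trace_sandwich[OF h\<rho> q] h_def hs_sq_def Y_def by (rule refl)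
  \<comment> \<open>The coefficients from \<open>q\<close> involve only the indices of
    \<open>R\<close>, so \<open>T\<close> passes through them by linearity: the blocks of the
    conjugated output are the images of the blocks of the conjugated input.\<close>
  have TY: "T (Y c c') s t = (\<Sum>e<r. \<Sum>e'<r. q $$ (c, e) * \<sigma> $$ (s * r + e, t * r + e') * q $$ (e', c'))"
    if "s < m * d" "t < m * d" for s t c c'
  proof -
    have "Y c c' = (\<lambda>a b. \<Sum>e<r. \<Sum>e'<r. q $$ (e', c') * (q $$ (c, e) * \<rho> $$ (a * r + e, b * r + e')))"
      unfolding Y_def by (intro ext sum.cong refl mult.commute)
    then have "T (Y c c') s t =
        (\<Sum>e<r. \<Sum>e'<r. q $$ (e', c') * (q $$ (c, e) * T (\<lambda>a b. \<rho> $$ (a * r + e, b * r + e')) s t))"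
      by (simp only: T_def kraus_map_sum finite_lessThan kraus_map_scale)
    also have "\<dots> = (\<Sum>e<r. \<Sum>e'<r. q $$ (c, e) * \<sigma> $$ (s * r + e, t * r + e') * q $$ (e', c'))"
      by (intro sum.cong refl) (simp only: \<sigma> that lessThan_iff, rule mult.commute)
    finally show ?thesis .
  qed
  have \<sigma>_entropy: "H2_cond (m * d) r \<sigma> = neg_log2 h'"
    unfolding H2_cond_def Let_def marginal S mat_trace_sandwich[OF h\<sigma> q] h'_def hs_sq_def
    by (simp add: TY)
  have h: "0 \<le> h" "0 \<le> h'" unfolding h_def h'_def by (simp_all add: sum_nonneg hs_sq_nonneg)
  \<comment> \<open>The constant \<open>C\<close> is the same for every block, so the bounds add up
    whatever \<open>r\<close> is.\<close>
  have "h' \<le> C * h"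
    unfolding h_def h'_def sum_distrib_left by (intro sum_mono contraction)
  moreover have "2 powr k * h \<le> 1"
  proof -
    have "ereal (log 2 (2 powr k)) \<le> neg_log2 h" using Hk by (simp add: \<rho>_entropy)
    then show ?thesis using h(1) by (subst (asm) neg_log2_ge_iff) auto
  qed
  ultimately have "real m * real d / (\<epsilon> + 1) * h' \<le> 1"
  proof -
    have "real m * real d / (\<epsilon> + 1) * h' \<le> real m * real d / (\<epsilon> + 1) * (C * h)"
      using \<open>h' \<le> C * h\<close> assms by (intro mult_left_mono) auto
    also have "\<dots> = (real m * real d / (\<epsilon> + 1) * ((\<epsilon> + 1) / (real m * real d))) * (2 powr k * h)"
      by (simp only: C_def ac_simps)
    also have "\<dots> = 2 powr k * h" using assms(1,3,6) by simp
    finally show ?thesis using \<open>2 powr k * h \<le> 1\<close> by simp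
  qed
  then show "ereal (log 2 (real m * real d / (\<epsilon> + 1))) \<le> H2_cond (m * d) r (ext_state_side m x d r U \<rho>)"
    unfolding \<sigma>_def[symmetric] \<sigma>_entropy using h assms by (subst neg_log2_ge_iff) auto
qed

end
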